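(* Let $k,\ell\ge 1$, $\lambda\in\mathrm{P}^k_\ell$, and let $z\in[0,b_\lambda]$ be such that $\lambda_1>\lambda_2>\cdots>\lambda_z$, and suppose further that $\lambda_z>\lambda_{z+1}$ when $z\neq b_\lambda$ (with the convention $\lambda_0=\infty$). Then there are integers $b_{\lambda\mu}$, indexed by $k$-bounded partitions $\mu$ and only finitely many nonzero, such that $$\mathfrak g^{(k)}_{\lambda,z+1}=\sum_{\mu} b_{\lambda\mu}\, g^{(k)}_\mu,\qquad\text{where } (-1)^{|\lambda|-|\mu|}b_{\lambda\mu}\in\mathbb Z_{\ge 0}\text{ for all }\mu .$$
   Context: Notation: $[a,b]=\{a,a+1,\dots,b\}$ (empty if $a>b$), $[b]=[1,b]$; $\epsilon_i\in\mathbb Z^\ell$ is the $i$-th unit vector; $|\gamma|=\sum_i\gamma_i$. $h_m$ is the complete homogeneous symmetric function ($h_0=1$, $h_m=0$ for $m<0$). For $m\in\mathbb Z$, $r\in\mathbb Z_{\ge0}$ put $k^{(r)}_m=\sum_{i=0}^{m}\binom{r+i-1}{i}h_{m-i}$, with $k^{(r)}_m=0$ for $m<0$ and $k^{(0)}_m=h_m$. For $\gamma\in\mathbb Z^\ell$ let $g_\gamma=\det\big(k^{(i-1)}_{\gamma_i+j-i}\big)_{1\le i,j\le\ell}$. Let $\Delta^+_\ell=\{(i,j):1\le i<j\le\ell\}$ with partial order $(a,b)\le(c,d)$ iff $a\ge c$ and $b\le d$; a root ideal is an upper order ideal $\Psi\subseteq\Delta^+_\ell$. For a root ideal $\Psi$,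 a multiset $M$ with support in $[\ell]$ and $\gamma\in\mathbb Z^\ell$, the Katalan function (Blasiak–Morse–Seelinger) is $K(\Psi;M;\gamma)=\prod_{z\in M}(1-L_z)\prod_{(i,j)\in\Psi}(1-R_{ij})^{-1}g_\gamma$, where the lowering and raising operators act on the index, $L_zg_\gamma=g_{\gamma-\epsilon_z}$, $R_{ij}g_\gamma=g_{\gamma+\epsilon_i-\epsilon_j}$, and $(1-R_{ij})^{-1}=\sum_{n\ge0}R_{ij}^n$. $\mathrm P^k_\ell$ denotes the set of $k$-bounded partitions with at most $\ell$ parts, written as $\ell$-tuples $\lambda=(\lambda_1\ge\cdots\ge\lambda_\ell\ge0)$ with $\lambda_1\le k$. For $\lambda\in\mathrm P^k_\ell$ let $\Delta^k(\lambda)=\{(i,j)\in\Delta^+_\ell: k-\lambda_i+i<j\}$ (a root ideal), and let $L(\Delta^k(\lambda))$ be the multiset of second coordinates $j$ of its elements $(i,j)$. Let $b_\lambda$ be the bottom of $\Delta^k(\lambda)$: the largest row index $x$ such that $\Delta^k(\lambda)$ contains some root $(x,p)$ ($b_\lambda=0$ if $\Delta^k(\lambda)=\emptyset$). For $x\in[b_\lambda]$ let $\mathrm{down}_\lambda(x)$ be the unique $j$ such that $(x,j)$ is a removable root of $\Delta^k(\lambda)$ (i.e. $\Delta^k(\lambda)\setminus\{(x,j)\}$ is still a root ideal); explicitly $\mathrm{down}_\lambda(x)=k-\lambda_x+x+1$. Weighted $K$-$k$-Schur function: for $z\in[b_\lambda+1]$, $\mathfrak g^{(k)}_{\lambda,z}:=K\big(\Delta^k(\lambda);\,L(\Delta^k(\lambda))\setminus\{\mathrm{down}_\lambda(x):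 x\in[z,b_\lambda]\};\,\lambda\big)$, where one copy of each listed value is removed from the multiset. $g^{(k)}_\mu$ is the $K$-$k$-Schur function (Lam–Schilling–Shimozono) of a $k$-bounded partition $\mu$; by a theorem of Blasiak–Morse–Seelinger, for $\mu\in\mathrm P^k_\ell$ it equals $K(\Delta^k(\mu);L(\Delta^{k+1}(\mu));\mu)$. *)

theory Defs
  imports "HOL-Library.Multiset" "Jordan_Normal_Form.Determinant"
begin

text \<open>
  Symmetric functions are taken in the ring of formal power series with integer coefficients
  in countably many variables \<open>x\<^sub>0, x\<^sub>1, \<dots>\<close>.  A monomial is
  encoded by the multiset of the indices of its variables, so \<open>{#i, i, j#}\<close> stands
  for \<open>x\<^sub>i\<^sup>2 x\<^sub>j\<close>, and the degree is the size.
\<close>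

lemma finite_submultisets: "finite {A. A \<subseteq># M}"
proof (induction M)
  case empty
  then show ?case by simp
next
  case (add x M)
  have "{A. A \<subseteq># add_mset x M} \<subseteq> {A. A \<subseteq># M} \<union> add_mset x ` {A. A \<subseteq># M}"
  proof
    fix A assume "A \<in> {A. A \<subseteq># add_mset x M}"
    then have A: "A \<subseteq># add_mset x M" by simp
    show "A \<in> {A. A \<subseteq># M} \<union> add_mset x ` {A. A \<subseteq># M}"
    proof (cases "x \<in># A")
      case True
      then obtain B where B: "A = add_mset x B" by (meson multi_member_split)
      with A have "B \<subseteq># M" by simp
      with B show ?thesis by blast
    next
      case False
      with A have "A \<subseteq># M"
        by (metis diff_single_trivial subset_eq_diff_conv add_mset_add_single)
      then show ?thesis by blast
    qed
  qed
  with add show ?case by (meson finite_UnI finite_imageI finite_subset)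
qed

typedef powser = "UNIV :: (nat multiset \<Rightarrow> int) set"
  morphisms pcoeff Abs_powser by simp

setup_lifting type_definition_powser

lemma powser_eqI: "(\<And>M. pcoeff f M = pcoeff g M) \<Longrightarrow> f = g"
  by (metis ext pcoeff_inject)

instantiation powser :: comm_ring_1
begin

lift_definition zero_powser :: powser is "\<lambda>_. 0" .
lift_definition one_powser :: powser is "\<lambda>M. if M = {#} then 1 else 0" .
lift_definition plus_powser :: "powser \<Rightarrow> powser \<Rightarrow> powser" is "\<lambda>f g M. f M + g M" .
lift_definition minus_powser :: "powser \<Rightarrow> powser \<Rightarrow> powser" is "\<lambda>f g M. f M - g M" .
lift_definition uminus_powser :: "powser \<Rightarrow> powser" is "\<lambda>f M. - f M" .
lift_definition times_powser :: "powser \<Rightarrow> powser \<Rightarrow> powser"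
  is "\<lambda>f g M. \<Sum>A | A \<subseteq># M. f A * g (M - A)" .

instance
proof
  fix f g h :: powser
  show "f + g + h = f + (g + h)" by transfer (simp add: add.assoc)
  show "f + g = g + f" by transfer (simp add: add.commute)
  show "0 + f = f" by transfer simp
  show "- f + f = 0" by transfer simp
  show "f - g = f + - g" by transfer simp
  show "(0::powser) \<noteq> 1" by transfer (metis zero_neq_one)
  show "(f + g) * h = f * h + g * h"
    by transfer (simp add: distrib_right sum.distrib)
  show "f * g = g * f"
  proof (transfer, rule ext)
    fix f g :: "nat multiset \<Rightarrow> int" and M
    show "(\<Sum>A | A \<subseteq># M. f A * g (M - A)) = (\<Sum>A | A \<subseteq># M. g A * f (M - A))"
      by (rule sum.reindex_bij_witness[of _ "\<lambda>A. M - A" "\<lambda>A. M - A"])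
        (auto simp: double_diff subset_mset.diff_diff_right mult.commute)
  qed
  show "1 * f = f"
  proof (transfer, rule ext)
    fix f :: "nat multiset \<Rightarrow> int" and M
    have "(\<Sum>A | A \<subseteq># M. (if A = {#} then 1 else 0) * f (M - A)) =
          (\<Sum>A \<in> {{#}}. (if A = {#} then 1 else 0) * f (M - A))"
      by (rule sum.mono_neutral_right) (auto simp: finite_submultisets)
    then show "(\<Sum>A | A \<subseteq># M. (if A = {#} then 1 else 0) * f (M - A)) = f M" by simp
  qed
  show "f * g * h = f * (g * h)"
  proof (transfer, rule ext)
    fix f g h :: "nat multiset \<Rightarrow> int" and M
    have "(\<Sum>A | A \<subseteq># M. (\<Sum>B | B \<subseteq># A. f B * g (A - B)) * h (M - A)) =
          (\<Sum>(A, B) \<in> (SIGMA A : {A. A \<subseteq># M}. {B. B \<subseteq># A}). f B * g (A - B) * h (M - A))"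
      by (simp add: sum_distrib_right sum.Sigma finite_submultisets)
    also have "\<dots> = (\<Sum>(B, C) \<in> (SIGMA B : {B. B \<subseteq># M}. {C. C \<subseteq># M - B}).
                       f B * (g C * h (M - B - C)))"
    proof (rule sum.reindex_bij_witness
             [of _ "\<lambda>(B, C). (B + C, B)" "\<lambda>(A, B). (B, A - B)"], goal_cases)
      case (1 a)
      then show ?case by (auto simp: subset_mset.add_diff_inverse)
    next
      case (2 a)
      then show ?case
        by (auto simp: subset_eq_diff_conv subset_mset.diff_add add.commute
            intro: subset_mset.order_trans)
    next
      case (3 b)
      then show ?case by auto
    next
      case (4 b)
      then show ?case
        by (auto simp: subset_mset.le_diff_conv2 add.commute)
    next
      case (5 a)
      then show ?case
        by (auto simp: mult.assoc diff_diff_add_mset subset_mset.add_diff_inverse)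
    qed
    also have "\<dots> = (\<Sum>B | B \<subseteq># M. f B * (\<Sum>C | C \<subseteq># M - B. g C * h (M - B - C)))"
      by (simp add: sum_distrib_left sum.Sigma finite_submultisets)
    finally show "(\<Sum>A | A \<subseteq># M. (\<Sum>B | B \<subseteq># A. f B * g (A - B)) * h (M - A)) =
                  (\<Sum>B | B \<subseteq># M. f B * (\<Sum>C | C \<subseteq># M - B. g C * h (M - B - C)))" .
  qed
qed

end

lift_definition hsym :: "nat \<Rightarrow> powser" is "\<lambda>m M. if size M = m then 1 else 0" .

text \<open>
  For \<open>r = 0\<close> the truncated subtraction is harmless: \<open>(i - 1) choose i\<close> is
  \<open>1\<close> for \<open>i = 0\<close> and \<open>0\<close> otherwise.
\<close>

definition ksym :: "nat \<Rightarrow> int \<Rightarrow> powser" where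
  "ksym r m = (if m < 0 then 0
     else \<Sum>i = 0..nat m. of_nat ((r + i - 1) choose i) * hsym (nat m - i))"

text \<open>
  Elements of \<open>\<int>\<^sup>l\<close> are functions \<open>nat \<Rightarrow> int\<close> whose
  entries are those at \<open>1, \<dots>, l\<close>.  Matrices are indexed from \<open>0\<close>.
\<close>

type_synonym vec_index = "nat \<Rightarrow> int"

definition gsym :: "nat \<Rightarrow> vec_index \<Rightarrow> powser" where
  "gsym l \<gamma> = det (mat l l (\<lambda>(i, j). ksym i (\<gamma> (Suc i) + int j - int i)))"

definition eps :: "nat \<Rightarrow> vec_index" where
  "eps i = (\<lambda>j. if j = i then 1 else 0)"

definition pos_roots :: "nat \<Rightarrow> (nat \<times> nat) set" where
  "pos_roots l = {(i, j). 1 \<le> i \<and> i < j \<and> j \<le> l}"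

definition root_le :: "nat \<times> nat \<Rightarrow> nat \<times> nat \<Rightarrow> bool" where
  "root_le \<alpha> \<beta> \<longleftrightarrow> fst \<alpha> \<ge> fst \<beta> \<and> snd \<alpha> \<le> snd \<beta>"

definition root_ideal :: "nat \<Rightarrow> (nat \<times> nat) set \<Rightarrow> bool" where
  "root_ideal l \<Psi> \<longleftrightarrow> \<Psi> \<subseteq> pos_roots l \<and>
     (\<forall>\<alpha>\<in>\<Psi>. \<forall>\<beta>\<in>pos_roots l. root_le \<alpha> \<beta> \<longrightarrow> \<beta> \<in> \<Psi>)"

text \<open>
  Operators on indices are rendered as operators on functions of the index.  The factors
  \<open>1 - L\<^sub>z\<close> commute, so the order in which the fold visits them is irrelevant.
  The product of the geometric series \<open>(1 - R\<^sub>i\<^sub>j)\<^sup>-\<^sup>1\<close> is expanded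
  into the sum over all exponent functions \<open>n\<close> supported on \<open>\<Psi>\<close>;
  only finitely many of its terms are nonzero, see \<open>finite_raise_terms\<close> below.
\<close>

definition lower_prod :: "nat multiset \<Rightarrow> (vec_index \<Rightarrow> powser) \<Rightarrow> vec_index \<Rightarrow> powser" where
  "lower_prod M G = fold_mset (\<lambda>z F \<gamma>. F \<gamma> - F (\<lambda>i. \<gamma> i - eps z i)) G M"

definition raise_index ::
  "(nat \<times> nat) set \<Rightarrow> (nat \<times> nat \<Rightarrow> nat) \<Rightarrow> vec_index \<Rightarrow> vec_index" where
  "raise_index \<Psi> n \<gamma> = (\<lambda>m. \<gamma> m + (\<Sum>(i, j)\<in>\<Psi>. int (n (i, j)) * (eps i m - eps j m)))"

definition raise_inv_prod ::
  "(nat \<times> nat) set \<Rightarrow> (vec_index \<Rightarrow> powser) \<Rightarrow> vec_index \<Rightarrow> powser" where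
  "raise_inv_prod \<Psi> G \<gamma> =
     (\<Sum>n | (\<forall>\<alpha>. \<alpha> \<notin> \<Psi> \<longrightarrow> n \<alpha> = 0) \<and> G (raise_index \<Psi> n \<gamma>) \<noteq> 0. G (raise_index \<Psi> n \<gamma>))"

definition Katalan ::
  "nat \<Rightarrow> (nat \<times> nat) set \<Rightarrow> nat multiset \<Rightarrow> vec_index \<Rightarrow> powser" where
  "Katalan l \<Psi> M \<gamma> = lower_prod M (raise_inv_prod \<Psi> (gsym l)) \<gamma>"

text \<open>
  A partition is extended by \<open>0\<close> to all indices, so that tuples differing by trailing
  zeros are the same function.
\<close>

definition bounded_partitions_len :: "nat \<Rightarrow> nat \<Rightarrow> vec_index set" where
  "bounded_partitions_len k l = {lam.
     (\<forall>i\<in>{1..l}. 0 \<le> lam i \<and> lam i \<le> int k) \<and>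
     (\<forall>i. 1 \<le> i \<and> i < l \<longrightarrow> lam (i + 1) \<le> lam i) \<and>
     (\<forall>i. i \<notin> {1..l} \<longrightarrow> lam i = 0)}"

definition bounded_partitions :: "nat \<Rightarrow> vec_index set" where
  "bounded_partitions k = (\<Union>l. bounded_partitions_len k l)"

definition part_length :: "vec_index \<Rightarrow> nat" where
  "part_length \<mu> = card {i. \<mu> i \<noteq> 0}"

definition part_size :: "vec_index \<Rightarrow> int" where
  "part_size \<mu> = (\<Sum>i | \<mu> i \<noteq> 0. \<mu> i)"

definition Delta :: "nat \<Rightarrow> nat \<Rightarrow> vec_index \<Rightarrow> (nat \<times> nat) set" where
  "Delta k l lam = {(i, j) \<in> pos_roots l. int k - lam i + int i < int j}"

definition Lmset :: "(nat \<times> nat) set \<Rightarrow> nat multiset" where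
  "Lmset \<Psi> = image_mset snd (mset_set \<Psi>)"

definition root_bottom :: "(nat \<times> nat) set \<Rightarrow> nat" where
  "root_bottom \<Psi> = Max (insert 0 (fst ` \<Psi>))"

definition removable_root :: "nat \<Rightarrow> (nat \<times> nat) set \<Rightarrow> nat \<times> nat \<Rightarrow> bool" where
  "removable_root l \<Psi> \<alpha> \<longleftrightarrow> \<alpha> \<in> \<Psi> \<and> root_ideal l (\<Psi> - {\<alpha>})"

definition down :: "nat \<Rightarrow> (nat \<times> nat) set \<Rightarrow> nat \<Rightarrow> nat" where
  "down l \<Psi> x = (THE j. removable_root l \<Psi> (x, j))"

definition weighted_KkSchur :: "nat \<Rightarrow> nat \<Rightarrow> vec_index \<Rightarrow> nat \<Rightarrow> powser" where
  "weighted_KkSchur k l lam z =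
     (let \<Psi> = Delta k l lam
      in Katalan l \<Psi> (Lmset \<Psi> - mset_set (down l \<Psi> ` {z..root_bottom \<Psi>})) lam)"

text \<open>
  The \<open>K\<close>-\<open>k\<close>-Schur function, through the formula of Blasiak, Morse and Seelinger.
  The value does not change when \<open>\<mu>\<close> is padded with zeros, since \<open>gsym\<close> vanishes on
  indices with negative last entry; the number of nonzero parts is used as \<open>l\<close>.
\<close>

definition KkSchur :: "nat \<Rightarrow> vec_index \<Rightarrow> powser" where
  "KkSchur k \<mu> =
     (let l = part_length \<mu> in Katalan l (Delta k l \<mu>) (Lmset (Delta (k + 1) l \<mu>)) \<mu>)"


lemma gsym_eq_0:
  assumes "1 \<le> i" "i \<le> l" "\<gamma> i < int i - int l"
  shows "gsym l \<gamma> = 0"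
proof -
  let ?A = "mat l l (\<lambda>(i, j). ksym i (\<gamma> (Suc i) + int j - int i))"
  have row: "?A $$ (i - 1, j) = 0" if "j < l" for j
    using assms that by (auto simp: ksym_def)
  have "(\<Prod>m = 0..<l. ?A $$ (m, p m)) = 0" if "p permutes {0..<l}" for p
  proof (rule prod_zero)
    have "i - 1 \<in> {0..<l}" using assms by auto
    moreover then have "p (i - 1) < l"
      using permutes_in_image[OF that, of "i - 1"] by simp
    ultimately show "\<exists>a\<in>{0..<l}. ?A $$ (a, p a) = 0" using row by blast
  qed simp
  then have "det ?A = 0"
    by (subst det_def') (auto intro!: sum.neutral)
  then show ?thesis by (simp add: gsym_def)
qed

lemma finite_raise_terms:
  assumes \<Psi>: "\<Psi> \<subseteq> pos_roots l"
  shows "finite {n. (\<forall>\<alpha>. \<alpha> \<notin> \<Psi> \<longrightarrow> n \<alpha> = 0) \<and> gsym l (raise_index \<Psi> n \<gamma>) \<noteq> 0}"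
proof -
  have fin: "finite \<Psi>"
    by (rule finite_subset[of _ "{1..l} \<times> {1..l}"]) (use \<Psi> in \<open>auto simp: pos_roots_def\<close>)
  define C where "C = (\<Sum>m = 1..l. \<bar>\<gamma> m\<bar>) + (\<Sum>m = 1..l. int l)"
  have bound: "int (n (a, b)) \<le> C"
    if nz: "gsym l (raise_index \<Psi> n \<gamma>) \<noteq> 0" and ab: "(a, b) \<in> \<Psi>" for n a b
  proof -
    have abl: "1 \<le> a" "a < b" "b \<le> l" using ab \<Psi> by (auto simp: pos_roots_def)
    have ge: "raise_index \<Psi> n \<gamma> m \<ge> int m - int l" if "m \<in> {b..l}" for m
      using gsym_eq_0[of m l "raise_index \<Psi> n \<gamma>"] nz that abl by (force simp: not_le)
    have eps_sum: "(\<Sum>m = b..l. eps i m) = (if i \<in> {b..l} then 1 else 0)" for i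
      by (simp add: eps_def)
    have "- (\<Sum>m = 1..l. int l) \<le> - (\<Sum>m = b..l. int l)"
      using abl by (simp add: sum_mono2)
    also have "\<dots> \<le> (\<Sum>m = b..l. raise_index \<Psi> n \<gamma> m)"
      unfolding sum_negf[symmetric] by (rule sum_mono) (use ge in force)
    also have "\<dots> = (\<Sum>m = b..l. \<gamma> m) +
        (\<Sum>(i, j)\<in>\<Psi>. int (n (i, j)) * ((\<Sum>m = b..l. eps i m) - (\<Sum>m = b..l. eps j m)))"
      unfolding raise_index_def sum.distrib
      by (subst sum.swap) (simp add: case_prod_unfold sum_distrib_left[symmetric] sum_subtractf)
    also have "(\<Sum>(i, j)\<in>\<Psi>. int (n (i, j)) * ((\<Sum>m = b..l. eps i m) - (\<Sum>m = b..l. eps j m)))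
        \<le> (\<Sum>\<alpha>\<in>\<Psi>. if \<alpha> = (a, b) then - int (n (a, b)) else 0)"
    proof (rule sum_mono, goal_cases)
      case (1 \<alpha>)
      then have "fst \<alpha> < snd \<alpha>" "snd \<alpha> \<le> l" using \<Psi> by (auto simp: pos_roots_def)
      then show ?case using abl by (cases \<alpha>) (auto simp: eps_sum)
    qed
    also have "\<dots> = - int (n (a, b))" using fin ab by simp
    also have "(\<Sum>m = b..l. \<gamma> m) \<le> (\<Sum>m = b..l. \<bar>\<gamma> m\<bar>)" by (rule sum_mono) simp
    also have "\<dots> \<le> (\<Sum>m = 1..l. \<bar>\<gamma> m\<bar>)" using abl by (intro sum_mono2) auto
    finally show ?thesis by (simp add: C_def)
  qed
  have "{n. (\<forall>\<alpha>. \<alpha> \<notin> \<Psi> \<longrightarrow> n \<alpha> = 0) \<and> gsym l (raise_index \<Psi> n \<gamma>) \<noteq> 0}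
      \<subseteq> {n. \<forall>\<alpha>. (\<alpha> \<in> \<Psi> \<longrightarrow> n \<alpha> \<in> {0..nat C}) \<and> (\<alpha> \<notin> \<Psi> \<longrightarrow> n \<alpha> = 0)}"
  proof (intro subsetI CollectI allI conjI impI)
    fix n \<alpha>
    assume n: "n \<in> {n. (\<forall>\<alpha>. \<alpha> \<notin> \<Psi> \<longrightarrow> n \<alpha> = 0) \<and> gsym l (raise_index \<Psi> n \<gamma>) \<noteq> 0}"
    show "n \<alpha> = 0" if "\<alpha> \<notin> \<Psi>" using n that by blast
    assume "\<alpha> \<in> \<Psi>"
    then have "int (n \<alpha>) \<le> C" using bound[of n "fst \<alpha>" "snd \<alpha>"] n by simp
    then show "n \<alpha> \<in> {0..nat C}" by simp
  qed
  then show ?thesis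
    by (rule finite_subset) (rule finite_set_of_finite_funs[OF fin], simp)
qed

lemma bounded_partitions_len_antimono:
  assumes lam: "lam \<in> bounded_partitions_len k l" and "1 \<le> i" "i \<le> j" "j \<le> l"
  shows "lam j \<le> lam i"
  using assms(3,4)
proof (induction j rule: dec_induct)
  case base
  then show ?case by simp
next
  case (step m)
  then have "lam (m + 1) \<le> lam m"
    using lam \<open>1 \<le> i\<close> by (auto simp: bounded_partitions_len_def)
  with step show ?case by simp
qed

lemma down_Delta:
  assumes lam: "lam \<in> bounded_partitions_len k l"
    and x: "1 \<le> x" "x \<le> root_bottom (Delta k l lam)"
  shows "int (down l (Delta k l lam) x) = int k - lam x + int x + 1"
proof -
  let ?P = "Delta k l lam"
  have fin: "finite ?P"
    by (rule finite_subset[of _ "{1..l} \<times> {1..l}"]) (auto simp: Delta_def pos_roots_def)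
  have "root_bottom ?P \<in> insert 0 (fst ` ?P)"
    unfolding root_bottom_def by (rule Max_in) (use fin in auto)
  then obtain p where p: "(root_bottom ?P, p) \<in> ?P" using x by auto
  then have b: "root_bottom ?P < l" "int k - lam (root_bottom ?P) + int (root_bottom ?P) < int l"
    by (auto simp: Delta_def pos_roots_def)
  have "lam (root_bottom ?P) \<le> lam x"
    using bounded_partitions_len_antimono[OF lam] x b by simp
  moreover have "lam x \<le> int k" using lam x b by (auto simp: bounded_partitions_len_def)
  moreover define d where "d = nat (int k - lam x + int x + 1)"
  ultimately have d: "int d = int k - lam x + int x + 1" "x < d" "d \<le> l"
    using x b by auto
  have xd: "(x, d) \<in> ?P" using d x by (auto simp: Delta_def pos_roots_def)
  have "removable_root l ?P (x, d)"
    unfolding removable_root_def root_ideal_def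
  proof (intro conjI ballI impI)
    show "(x, d) \<in> ?P" by (fact xd)
    show "?P - {(x, d)} \<subseteq> pos_roots l" by (auto simp: Delta_def)
    fix \<alpha> \<beta> assume \<alpha>: "\<alpha> \<in> ?P - {(x, d)}" and \<beta>: "\<beta> \<in> pos_roots l" and le: "root_le \<alpha> \<beta>"
    obtain i j where ij: "\<alpha> = (i, j)" by (cases \<alpha>)
    obtain c e where ce: "\<beta> = (c, e)" by (cases \<beta>)
    have *: "1 \<le> i" "i < j" "j \<le> l" "int k - lam i + int i < int j" "(i, j) \<noteq> (x, d)"
      using \<alpha> ij by (auto simp: Delta_def pos_roots_def)
    have **: "1 \<le> c" "c < e" "e \<le> l" "c \<le> i" "j \<le> e"
      using \<beta> le ij ce by (auto simp: pos_roots_def root_le_def)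
    have lam_le: "lam i \<le> lam c"
      using bounded_partitions_len_antimono[OF lam] * ** by simp
    have "(c, e) \<in> ?P" using * ** lam_le by (auto simp: Delta_def pos_roots_def)
    moreover have "(c, e) \<noteq> (x, d)" using * ** lam_le d by auto
    ultimately show "\<beta> \<in> ?P - {(x, d)}" using ce by simp
  qed
  moreover have "j = d" if "removable_root l ?P (x, j)" for j
  proof (rule ccontr)
    assume "j \<noteq> d"
    have j: "(x, j) \<in> ?P" and ideal: "root_ideal l (?P - {(x, j)})"
      using that by (auto simp: removable_root_def)
    then have "d \<le> j" "(x, j) \<in> pos_roots l" using d by (auto simp: Delta_def)
    moreover have "(x, d) \<in> ?P - {(x, j)}" using xd \<open>j \<noteq> d\<close> by simp
    moreover have "root_le (x, d) (x, j)" using \<open>d \<le> j\<close> by (simp add: root_le_def)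
    ultimately have "(x, j) \<in> ?P - {(x, j)}"
      using ideal unfolding root_ideal_def by blast
    then show False by simp
  qed
  ultimately have "down l ?P x = d" unfolding down_def by (rule the_equality)
  with d show ?thesis by simp
qed

end

theory Submission
  imports Defs
begin

text \<open>
  Write \<open>dn(i) = k - \<lambda>\<^sub>i + i + 1\<close>.  Passing from \<open>z\<close> to \<open>z + 1\<close>
  multiplies the weighted function \<open>g\<^sub>\<lambda>\<close> by \<open>1 - L\<close> in column \<open>dn(z)\<close>,
  and the bounce path \<open>z, dn(z), dn(dn(z)), \<dots>\<close> is followed downwards.  Let \<open>T(\<lambda>, p)\<close>
  be \<open>1 - L\<close> in column \<open>d = dn(p)\<close> applied to \<open>g\<^sub>\<lambda>\<close>.  Expanding in the root
  \<open>(d, dn(d))\<close> gives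
  \<open>T(\<lambda>, p) = T(\<lambda>, d) - T(\<lambda> - \<epsilon>\<^sub>d, d)\<close> if \<open>\<lambda>\<^sub>d > \<lambda>\<^sub>d\<^sub>+\<^sub>1\<close>,
  and \<open>T(\<lambda>, p) = T(\<lambda>, d)\<close> if \<open>\<lambda>\<^sub>d = \<lambda>\<^sub>d\<^sub>+\<^sub>1\<close>.
  In the second case the vanishing of the other term is the mirror lemma of Blasiak, Morse and
  Seelinger, which needs a strict descent of \<open>\<lambda>\<close> somewhere above on the path; the descent
  at \<open>z\<close> provides it, and lowering parts further down never destroys it.  Every step down by
  one box carries one minus sign, which is the alternation, and the parts \<open>\<lambda>\<^sub>1, \<dots>, \<lambda>\<^sub>z\<close>
  stay untouched, so that one can induct on \<open>z\<close> down to the \<open>K\<close>-\<open>k\<close>-Schur functions.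
\<close>

subsection \<open>Operator calculus and straightening\<close>

lemma lower_prod_empty [simp]: "lower_prod {#} G = G"
  by (simp add: lower_prod_def)

lemma lower_prod_add_mset:
  "lower_prod (add_mset z M) G \<gamma> = lower_prod M G \<gamma> - lower_prod M G (\<lambda>i. \<gamma> i - eps z i)"
proof -
  interpret comp_fun_commute "\<lambda>z (F :: vec_index \<Rightarrow> powser) \<gamma>. F \<gamma> - F (\<lambda>i. \<gamma> i - eps z i)"
    by standard (auto simp: fun_eq_iff algebra_simps)
  show ?thesis by (simp add: lower_prod_def)
qed

lemma lower_prod_add:
  "lower_prod M (\<lambda>\<gamma>. F \<gamma> + G \<gamma>) \<gamma> = lower_prod M F \<gamma> + lower_prod M G \<gamma>"
  by (induction M arbitrary: \<gamma>) (simp_all add: lower_prod_add_mset algebra_simps)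

lemma lower_prod_diff:
  "lower_prod M (\<lambda>\<gamma>. F \<gamma> - G \<gamma>) \<gamma> = lower_prod M F \<gamma> - lower_prod M G \<gamma>"
  by (induction M arbitrary: \<gamma>) (simp_all add: lower_prod_add_mset algebra_simps)

lemma lower_prod_uminus: "lower_prod M (\<lambda>\<gamma>. - F \<gamma>) \<gamma> = - lower_prod M F \<gamma>"
  by (induction M arbitrary: \<gamma>) (simp_all add: lower_prod_add_mset)

lemma lower_prod_shift:
  "lower_prod M (\<lambda>\<gamma>. F (\<lambda>m. \<gamma> m + v m)) \<gamma> = lower_prod M F (\<lambda>m. \<gamma> m + v m)"
proof (induction M arbitrary: \<gamma>)
  case (add z M)
  have "(\<lambda>m. \<gamma> m - eps z m + v m) = (\<lambda>m. \<gamma> m + v m - eps z m)" by auto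
  with add show ?case by (simp add: lower_prod_add_mset)
qed simp

definition raise_exps :: "(nat \<times> nat) set \<Rightarrow> (nat \<times> nat \<Rightarrow> nat) set" where
  "raise_exps \<Psi> = {n. \<forall>\<alpha>. \<alpha> \<notin> \<Psi> \<longrightarrow> n \<alpha> = 0}"

lemma raise_inv_prod_eq_sum:
  assumes "finite S" "S \<subseteq> raise_exps \<Psi>"
    and "\<And>n. n \<in> raise_exps \<Psi> \<Longrightarrow> G (raise_index \<Psi> n \<gamma>) \<noteq> 0 \<Longrightarrow> n \<in> S"
  shows "raise_inv_prod \<Psi> G \<gamma> = (\<Sum>n\<in>S. G (raise_index \<Psi> n \<gamma>))"
  unfolding raise_inv_prod_def
  by (rule sum.mono_neutral_left) (use assms in \<open>auto simp: raise_exps_def\<close>)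

lemma finite_root_set: "\<Psi> \<subseteq> pos_roots l \<Longrightarrow> finite \<Psi>"
  by (rule finite_subset[of _ "{1..l} \<times> {1..l}"]) (auto simp: pos_roots_def)

lemma raise_index_add:
  "raise_index \<Psi> n (\<lambda>m. \<gamma> m + v m) = (\<lambda>m. raise_index \<Psi> n \<gamma> m + v m)"
  by (auto simp: raise_index_def)

lemma raise_index_Diff:
  assumes "finite \<Psi>" "n \<alpha> = 0"
  shows "raise_index (\<Psi> - {\<alpha>}) n \<gamma> = raise_index \<Psi> n \<gamma>"
proof -
  have "(\<Sum>(i, j)\<in>\<Psi> - {\<alpha>}. int (n (i, j)) * (eps i m - eps j m)) =
        (\<Sum>(i, j)\<in>\<Psi>. int (n (i, j)) * (eps i m - eps j m))" for m
    by (rule sum.mono_neutral_left) (use assms in \<open>auto\<close>)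
  then show ?thesis by (simp add: raise_index_def)
qed

lemma raise_index_fun_upd:
  assumes "finite \<Psi>" "(a, b) \<in> \<Psi>"
  shows "raise_index \<Psi> (n((a, b) := Suc (n (a, b)))) \<gamma> =
         raise_index \<Psi> n (\<lambda>m. \<gamma> m + (eps a m - eps b m))"
proof -
  have "(\<Sum>(i, j)\<in>\<Psi>. int ((n((a, b) := Suc (n (a, b)))) (i, j)) * (eps i m - eps j m)) =
        (\<Sum>(i, j)\<in>\<Psi>. int (n (i, j)) * (eps i m - eps j m)) + (eps a m - eps b m)" for m
  proof -
    have "(\<Sum>(i, j)\<in>\<Psi>. int ((n((a, b) := Suc (n (a, b)))) (i, j)) * (eps i m - eps j m)) =
          (\<Sum>(i, j)\<in>\<Psi>. int (n (i, j)) * (eps i m - eps j m)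
             + (if (i, j) = (a, b) then eps a m - eps b m else 0))"
      by (rule sum.cong) (auto simp: algebra_simps)
    moreover have "(\<Sum>(i, j)\<in>\<Psi>. if (i, j) = (a, b) then eps a m - eps b m else 0) =
        eps a m - eps b m"
      using assms sum.delta[of \<Psi> "(a, b)" "\<lambda>_. eps a m - eps b m"]
      by (simp add: case_prod_unfold prod_eq_iff)
    ultimately show ?thesis by (simp add: case_prod_unfold sum.distrib)
  qed
  then show ?thesis unfolding raise_index_def by (intro ext) (simp only: add_ac)
qed

text \<open>With R the raising operator of (a, b), this is 1/(1 - R) = 1 + R/(1 - R): exponents
  vanishing at (a, b) give the first term; from the others one factor R moves into the
  index.\<close>

lemma raise_inv_prod_remove_root:
  assumes \<Psi>: "\<Psi> \<subseteq> pos_roots l" and ab: "(a, b) \<in> \<Psi>"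
  shows "raise_inv_prod \<Psi> (gsym l) \<gamma> =
    raise_inv_prod (\<Psi> - {(a, b)}) (gsym l) \<gamma> +
    raise_inv_prod \<Psi> (gsym l) (\<lambda>m. \<gamma> m + (eps a m - eps b m))"
proof -
  let ?G = "gsym l" and ?v = "\<lambda>m. \<gamma> m + (eps a m - eps b m)"
  let ?up = "\<lambda>n :: nat \<times> nat \<Rightarrow> nat. n((a, b) := Suc (n (a, b)))"
  let ?dn = "\<lambda>n :: nat \<times> nat \<Rightarrow> nat. n((a, b) := n (a, b) - 1)"
  define N where "N = {n \<in> raise_exps \<Psi>. ?G (raise_index \<Psi> n \<gamma>) \<noteq> 0}"
  have fin\<Psi>: "finite \<Psi>" using \<Psi> by (rule finite_root_set)
  have fin: "finite N"
    using finite_raise_terms[OF \<Psi>, of \<gamma>] by (simp add: N_def raise_exps_def)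
  have "raise_inv_prod \<Psi> ?G \<gamma> = (\<Sum>n\<in>N. ?G (raise_index \<Psi> n \<gamma>))"
    by (rule raise_inv_prod_eq_sum) (use fin in \<open>auto simp: N_def\<close>)
  also have "\<dots> = (\<Sum>n\<in>{n \<in> N. n (a, b) = 0}. ?G (raise_index \<Psi> n \<gamma>)) +
                  (\<Sum>n\<in>{n \<in> N. n (a, b) \<noteq> 0}. ?G (raise_index \<Psi> n \<gamma>))"
    by (subst sum.union_disjoint[symmetric]) (use fin in \<open>auto intro: sum.cong\<close>)
  also have "(\<Sum>n\<in>{n \<in> N. n (a, b) = 0}. ?G (raise_index \<Psi> n \<gamma>)) =
             (\<Sum>n\<in>{n \<in> N. n (a, b) = 0}. ?G (raise_index (\<Psi> - {(a, b)}) n \<gamma>))"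
    by (rule sum.cong) (use fin\<Psi> in \<open>auto simp: raise_index_Diff\<close>)
  also have "\<dots> = raise_inv_prod (\<Psi> - {(a, b)}) ?G \<gamma>"
  proof (rule raise_inv_prod_eq_sum[symmetric])
    show "finite {n \<in> N. n (a, b) = 0}" using fin by simp
  qed (auto simp: N_def raise_exps_def raise_index_Diff[OF fin\<Psi>])
  also have "(\<Sum>n\<in>{n \<in> N. n (a, b) \<noteq> 0}. ?G (raise_index \<Psi> n \<gamma>)) =
             (\<Sum>n\<in>?dn ` {n \<in> N. n (a, b) \<noteq> 0}. ?G (raise_index \<Psi> n ?v))"
    by (rule sum.reindex_bij_witness[of _ ?up ?dn])
      (auto simp: raise_index_fun_upd[OF fin\<Psi> ab, symmetric])
  also have "\<dots> = raise_inv_prod \<Psi> ?G ?v"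
  proof (rule raise_inv_prod_eq_sum[symmetric])
    fix n assume n: "n \<in> raise_exps \<Psi>" "?G (raise_index \<Psi> n ?v) \<noteq> 0"
    then have "?up n \<in> {n \<in> N. n (a, b) \<noteq> 0}"
      using ab by (auto simp: N_def raise_exps_def raise_index_fun_upd[OF fin\<Psi> ab])
    moreover have "n = ?dn (?up n)" by simp
    ultimately show "n \<in> ?dn ` {n \<in> N. n (a, b) \<noteq> 0}" by (metis (no_types, lifting) image_eqI)
  next
    show "finite (?dn ` {n \<in> N. n (a, b) \<noteq> 0})" using fin by simp
  qed (use ab in \<open>auto simp: N_def raise_exps_def\<close>)
  finally show ?thesis .
qed

lemma Katalan_add_mset:
  "Katalan l \<Psi> (add_mset z M) \<gamma> = Katalan l \<Psi> M \<gamma> - Katalan l \<Psi> M (\<lambda>i. \<gamma> i - eps z i)"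
  by (simp add: Katalan_def lower_prod_add_mset)

lemma Katalan_remove_root:
  assumes "\<Psi> \<subseteq> pos_roots l" "(a, b) \<in> \<Psi>"
  shows "Katalan l \<Psi> M \<gamma> =
    Katalan l (\<Psi> - {(a, b)}) M \<gamma> + Katalan l \<Psi> M (\<lambda>m. \<gamma> m + eps a m - eps b m)"
proof -
  have *: "raise_inv_prod \<Psi> (gsym l) = (\<lambda>\<gamma>. raise_inv_prod (\<Psi> - {(a, b)}) (gsym l) \<gamma> +
          raise_inv_prod \<Psi> (gsym l) (\<lambda>m. \<gamma> m + (eps a m - eps b m)))"
    using raise_inv_prod_remove_root[OF assms] by blast
  have "lower_prod M (raise_inv_prod \<Psi> (gsym l)) \<gamma> =
    lower_prod M (raise_inv_prod (\<Psi> - {(a, b)}) (gsym l)) \<gamma> +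
    lower_prod M (raise_inv_prod \<Psi> (gsym l)) (\<lambda>m. \<gamma> m + (eps a m - eps b m))"
    by (rule trans[OF fun_cong[OF arg_cong[OF *]]])
      (simp only: lower_prod_add lower_prod_shift[of M "raise_inv_prod \<Psi> (gsym l)"])
  then show ?thesis by (simp add: Katalan_def add_diff_eq)
qed

text \<open>The generating series of \<open>ksym r\<close> is that of the h's divided by
  \<open>(1 - t)^r\<close>, and multiplying by 1 - t lowers r by one; on coefficients this is
  Pascal's rule.\<close>

lemma ksym_diff: "ksym (Suc r) m - ksym (Suc r) (m - 1) = ksym r m"
proof (cases "m \<le> 0")
  case True
  then show ?thesis by (cases "m = 0") (auto simp: ksym_def)
next
  case False
  define n where "n = nat (m - 1)"
  have m: "m = int (Suc n)" using False by (simp add: n_def)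
  have "(\<Sum>i = 0..n. of_nat ((Suc r + i - 1) choose i) * hsym (n - i)) =
        (\<Sum>i = Suc 0..Suc n. of_nat ((r + i - 1) choose (i - 1)) * hsym (Suc n - i))"
    by (subst sum.shift_bounds_cl_Suc_ivl) simp
  moreover have "(\<Sum>i = Suc 0..Suc n. of_nat ((Suc r + i - 1) choose i) * hsym (Suc n - i)) =
     (\<Sum>i = Suc 0..Suc n. of_nat ((r + i - 1) choose (i - 1)) * hsym (Suc n - i)) +
     (\<Sum>i = Suc 0..Suc n. of_nat ((r + i - 1) choose i) * hsym (Suc n - i))"
  proof (subst sum.distrib[symmetric], rule sum.cong)
    fix i assume "i \<in> {Suc 0..Suc n}"
    then obtain j where "i = Suc j" by (cases i) auto
    then show "of_nat ((Suc r + i - 1) choose i) * hsym (Suc n - i) =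
      of_nat ((r + i - 1) choose (i - 1)) * hsym (Suc n - i) +
      of_nat ((r + i - 1) choose i) * hsym (Suc n - i)"
      by (simp add: distrib_right)
  qed simp
  moreover have "ksym q (int (Suc n)) = hsym (Suc n) +
    (\<Sum>i = Suc 0..Suc n. of_nat ((q + i - 1) choose i) * hsym (Suc n - i))" for q
    unfolding ksym_def by (subst sum.atLeast_Suc_atMost) (simp_all only: nat_int, simp_all)
  moreover have "ksym (Suc r) (int n) =
    (\<Sum>i = 0..n. of_nat ((Suc r + i - 1) choose i) * hsym (n - i))"
    by (simp add: ksym_def)
  moreover have "m - 1 = int n" using m by simp
  ultimately show ?thesis
    unfolding m by (simp only: add_diff_cancel_left add_diff_cancel_left' add_diff_eq[symmetric])
qed

text \<open>
  The transposition of rows \<open>d\<close> and \<open>d + 1\<close> in the determinant: row \<open>i\<close> of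
  \<open>gsym\<close> is governed by \<open>\<gamma> i - i\<close>, hence the shift.
\<close>

definition swap_index :: "nat \<Rightarrow> vec_index \<Rightarrow> vec_index" where
  "swap_index d \<gamma> = (\<lambda>m. \<gamma> (transpose d (Suc d) m) + eps (Suc d) m - eps d m)"

text \<open>Only row d differs (rows counted from 0), so multilinearity and \<open>ksym_diff\<close>
  merge the determinants. Rows d - 1 and d then share the superscript d - 1, and exchanging them
  becomes a change of the index.\<close>

lemma gsym_diff_eq_det:
  assumes "1 \<le> d" "d < l"
  shows "gsym l \<gamma> - gsym l (\<lambda>m. \<gamma> m - eps (Suc d) m) =
    det (mat l l (\<lambda>(i, j). ksym (if i = d then d - 1 else i) (\<gamma> (Suc i) + int j - int i)))"
proof -
  let ?A = "\<lambda>\<gamma>. mat l l (\<lambda>(i, j). ksym i (\<gamma> (Suc i) + int j - int i))"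
  let ?B = "mat l l (\<lambda>(i, j). ksym (if i = d then d - 1 else i) (\<gamma> (Suc i) + int j - int i))"
  let ?\<gamma> = "\<lambda>m. \<gamma> m - eps (Suc d) m"
  have "(\<Prod>i = 0..<l. ?A \<gamma> $$ (i, p i)) - (\<Prod>i = 0..<l. ?A ?\<gamma> $$ (i, p i)) =
        (\<Prod>i = 0..<l. ?B $$ (i, p i))" if p: "p permutes {0..<l}" for p
  proof -
    have pl: "p i < l" if "i < l" for i
      using permutes_in_image[OF p, of i] that by simp
    have split: "(\<Prod>i = 0..<l. f i) = f d * (\<Prod>i\<in>{0..<l} - {d}. f i)" for f :: "nat \<Rightarrow> powser"
      using assms by (intro prod.remove) auto
    have r1: "(\<Prod>i\<in>{0..<l} - {d}. ?A ?\<gamma> $$ (i, p i)) = (\<Prod>i\<in>{0..<l} - {d}. ?A \<gamma> $$ (i, p i))"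
      by (rule prod.cong) (auto simp: pl eps_def)
    have r2: "(\<Prod>i\<in>{0..<l} - {d}. ?B $$ (i, p i)) = (\<Prod>i\<in>{0..<l} - {d}. ?A \<gamma> $$ (i, p i))"
      by (rule prod.cong) (auto simp: pl)
    have "?A \<gamma> $$ (d, p d) - ?A ?\<gamma> $$ (d, p d) = ?B $$ (d, p d)"
      using assms pl[of d] ksym_diff[of "d - 1" "\<gamma> (Suc d) + int (p d) - int d"]
      by (simp add: eps_def algebra_simps)
    then show ?thesis
      unfolding split[of "\<lambda>i. ?A \<gamma> $$ (i, p i)"] split[of "\<lambda>i. ?A ?\<gamma> $$ (i, p i)"]
        split[of "\<lambda>i. ?B $$ (i, p i)"] r1 r2 left_diff_distrib[symmetric]
      by (rule arg_cong)
  qed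
  then have "signof p * (\<Prod>i = 0..<l. ?A \<gamma> $$ (i, p i)) -
      signof p * (\<Prod>i = 0..<l. ?A ?\<gamma> $$ (i, p i)) = signof p * (\<Prod>i = 0..<l. ?B $$ (i, p i))"
    if "p permutes {0..<l}" for p
    unfolding right_diff_distrib[symmetric] using that by (intro arg_cong[where f = "(*) (signof p)"])
  then have "(\<Sum>p | p permutes {0..<l}. signof p * (\<Prod>i = 0..<l. ?A \<gamma> $$ (i, p i))) -
      (\<Sum>p | p permutes {0..<l}. signof p * (\<Prod>i = 0..<l. ?A ?\<gamma> $$ (i, p i))) =
      (\<Sum>p | p permutes {0..<l}. signof p * (\<Prod>i = 0..<l. ?B $$ (i, p i)))"
    unfolding sum_subtractf[symmetric] by (intro sum.cong refl) blast
  then show ?thesis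
    unfolding gsym_def det_def'[OF mat_carrier] .
qed

lemma gsym_diff_swap_index:
  assumes "1 \<le> d" "d < l"
  shows "gsym l (swap_index d \<gamma>) - gsym l (\<lambda>m. swap_index d \<gamma> m - eps (Suc d) m) =
    - (gsym l \<gamma> - gsym l (\<lambda>m. \<gamma> m - eps (Suc d) m))"
proof -
  let ?B = "\<lambda>\<gamma>. mat l l (\<lambda>(i, j). ksym (if i = d then d - 1 else i) (\<gamma> (Suc i) + int j - int i))"
  have "?B (swap_index d \<gamma>) = swaprows (d - 1) d (?B \<gamma>)"
    by (rule eq_matI) (use assms in \<open>auto simp: swap_index_def eps_def transpose_def of_nat_diff
        algebra_simps\<close>)
  then have "det (?B (swap_index d \<gamma>)) = - det (?B \<gamma>)"
    using det_swaprows[of "d - 1" l d "?B \<gamma>"] assms by simp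
  then show ?thesis by (simp add: gsym_diff_eq_det[OF assms])
qed

abbreviation swap_root :: "nat \<Rightarrow> nat \<times> nat \<Rightarrow> nat \<times> nat" where
  "swap_root d \<equiv> map_prod (transpose d (Suc d)) (transpose d (Suc d))"

lemma swap_root_swap_root [simp]: "swap_root d (swap_root d \<alpha>) = \<alpha>"
  by (cases \<alpha>) simp

lemma raise_index_swap:
  assumes "\<And>\<alpha>. \<alpha> \<in> \<Psi> \<Longrightarrow> swap_root d \<alpha> \<in> \<Psi>"
  shows "raise_index \<Psi> (n \<circ> swap_root d) (swap_index d \<gamma>) = swap_index d (raise_index \<Psi> n \<gamma>)"
proof
  fix m
  let ?s = "transpose d (Suc d)"
  have eps: "eps (?s i) m = eps i (?s m)" for i
    by (auto simp: eps_def transpose_eq_iff)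
  have "(\<Sum>(i, j)\<in>\<Psi>. int ((n \<circ> swap_root d) (i, j)) * (eps i m - eps j m)) =
        (\<Sum>(i, j)\<in>\<Psi>. int (n (i, j)) * (eps i (?s m) - eps j (?s m)))"
    by (rule sum.reindex_bij_witness[of _ "swap_root d" "swap_root d"])
      (use assms in \<open>auto simp: eps[symmetric]\<close>)
  then show "raise_index \<Psi> (n \<circ> swap_root d) (swap_index d \<gamma>) m = swap_index d (raise_index \<Psi> n \<gamma>) m"
    by (simp add: raise_index_def swap_index_def)
qed

lemma raise_inv_prod_diff_swap_index:
  assumes \<Psi>: "\<Psi> \<subseteq> pos_roots l" and inv: "\<And>\<alpha>. \<alpha> \<in> \<Psi> \<Longrightarrow> swap_root d \<alpha> \<in> \<Psi>"
    and d: "1 \<le> d" "d < l"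
  shows "raise_inv_prod \<Psi> (gsym l) (swap_index d \<gamma>)
      - raise_inv_prod \<Psi> (gsym l) (\<lambda>m. swap_index d \<gamma> m - eps (Suc d) m) =
    - (raise_inv_prod \<Psi> (gsym l) \<gamma> - raise_inv_prod \<Psi> (gsym l) (\<lambda>m. \<gamma> m - eps (Suc d) m))"
proof -
  let ?G = "gsym l" and ?low = "\<lambda>(\<gamma> :: vec_index) m. \<gamma> m - eps (Suc d) m"
  let ?sw = "\<lambda>n :: nat \<times> nat \<Rightarrow> nat. n \<circ> swap_root d"
  define N where "N \<gamma> = {n \<in> raise_exps \<Psi>. ?G (raise_index \<Psi> n \<gamma>) \<noteq> 0}" for \<gamma>
  have fin: "finite (N \<gamma>)" for \<gamma>
    using finite_raise_terms[OF \<Psi>, of \<gamma>] by (simp add: N_def raise_exps_def)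
  have sw_sw: "?sw (?sw n) = n" for n by (simp add: fun_eq_iff)
  have inv': "swap_root d \<alpha> \<in> \<Psi> \<longleftrightarrow> \<alpha> \<in> \<Psi>" for \<alpha>
    using inv[of \<alpha>] inv[of "swap_root d \<alpha>"] by auto
  have sw_exps: "?sw n \<in> raise_exps \<Psi>" if "n \<in> raise_exps \<Psi>" for n
    using that inv' unfolding raise_exps_def mem_Collect_eq comp_def by blast
  \<comment> \<open>\<open>S\<close> contains the nonzero exponents for \<gamma> and its lowering,
    and its image under the swap those for the swapped indices.\<close>
  define S where "S = N \<gamma> \<union> N (?low \<gamma>) \<union> ?sw ` (N (swap_index d \<gamma>) \<union> N (?low (swap_index d \<gamma>)))"
  have S: "finite S" "S \<subseteq> raise_exps \<Psi>"
    using fin sw_exps by (auto simp: S_def N_def)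
  have low: "raise_index \<Psi> n (?low \<gamma>) = ?low (raise_index \<Psi> n \<gamma>)" for n \<gamma>
    using raise_index_add[of \<Psi> n \<gamma> "\<lambda>m. - eps (Suc d) m"] by simp
  have eq: "raise_inv_prod \<Psi> ?G \<gamma> - raise_inv_prod \<Psi> ?G (?low \<gamma>) =
      (\<Sum>n\<in>T. ?G (raise_index \<Psi> n \<gamma>) - ?G (?low (raise_index \<Psi> n \<gamma>)))"
    if "finite T" "T \<subseteq> raise_exps \<Psi>" "N \<gamma> \<union> N (?low \<gamma>) \<subseteq> T" for T \<gamma>
  proof -
    have "raise_inv_prod \<Psi> ?G \<gamma> = (\<Sum>n\<in>T. ?G (raise_index \<Psi> n \<gamma>))"
      "raise_inv_prod \<Psi> ?G (?low \<gamma>) = (\<Sum>n\<in>T. ?G (raise_index \<Psi> n (?low \<gamma>)))"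
      by (rule raise_inv_prod_eq_sum; use that in \<open>auto simp: N_def\<close>)+
    then show ?thesis by (simp add: low sum_subtractf)
  qed
  have sub: "N (swap_index d \<gamma>) \<union> N (?low (swap_index d \<gamma>)) \<subseteq> ?sw ` S"
  proof
    fix n assume "n \<in> N (swap_index d \<gamma>) \<union> N (?low (swap_index d \<gamma>))"
    then have "?sw n \<in> S" by (auto simp: S_def)
    then show "n \<in> ?sw ` S" using sw_sw[of n] by (metis imageI)
  qed
  have "raise_inv_prod \<Psi> ?G (swap_index d \<gamma>) - raise_inv_prod \<Psi> ?G (?low (swap_index d \<gamma>)) =
      (\<Sum>n\<in>?sw ` S. ?G (raise_index \<Psi> n (swap_index d \<gamma>)) -
        ?G (?low (raise_index \<Psi> n (swap_index d \<gamma>))))"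
    by (rule eq[OF _ _ sub]) (use S sw_exps in auto)
  also have "\<dots> = (\<Sum>n\<in>S. ?G (raise_index \<Psi> (?sw n) (swap_index d \<gamma>)) -
        ?G (?low (raise_index \<Psi> (?sw n) (swap_index d \<gamma>))))"
    by (rule sum.reindex_cong[of ?sw]) (use sw_sw in \<open>auto intro: inj_on_inverseI[of _ ?sw]\<close>)
  also have "\<dots> = (\<Sum>n\<in>S. - (?G (raise_index \<Psi> n \<gamma>) - ?G (?low (raise_index \<Psi> n \<gamma>))))"
    by (simp only: raise_index_swap[of \<Psi> d, OF inv] gsym_diff_swap_index[OF d])
  also have "\<dots> = - (raise_inv_prod \<Psi> ?G \<gamma> - raise_inv_prod \<Psi> ?G (?low \<gamma>))"
    unfolding sum_negf by (subst eq[of S]) (use S in \<open>auto simp: S_def\<close>)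
  finally show ?thesis .
qed

lemma lower_prod_swap_index:
  "lower_prod M F (swap_index d \<gamma>) =
   lower_prod (image_mset (transpose d (Suc d)) M) (\<lambda>\<gamma>. F (swap_index d \<gamma>)) \<gamma>"
proof (induction M arbitrary: \<gamma>)
  case (add z M)
  have "(\<lambda>i. swap_index d \<gamma> i - eps z i) =
        swap_index d (\<lambda>i. \<gamma> i - eps (transpose d (Suc d) z) i)"
    by (auto simp: swap_index_def eps_def fun_eq_iff transpose_eq_iff)
  with add show ?case by (simp add: lower_prod_add_mset)
qed simp

lemma lower_prod_add_mset':
  "lower_prod (add_mset z M) F \<gamma> = lower_prod M (\<lambda>\<gamma>. F \<gamma> - F (\<lambda>i. \<gamma> i - eps z i)) \<gamma>"
  using lower_prod_shift[of M F "\<lambda>i. - eps z i"]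
  by (simp add: lower_prod_add_mset lower_prod_diff)

text \<open>Integer coefficients admit no 2-torsion; this turns antisymmetry into vanishing.\<close>

lemma powser_eq_uminus_iff: "f = - f \<longleftrightarrow> f = (0 :: powser)"
proof
  assume "f = - f"
  then have "pcoeff f M = - pcoeff f M" for M by (metis uminus_powser.rep_eq)
  then have "pcoeff f M = 0" for M by (metis equal_neg_zero)
  then show "f = 0" by (auto intro!: powser_eqI simp: zero_powser.rep_eq)
qed simp

text \<open>Once a factor 1 - L in column d + 1 is split off, the root set, the remaining multiset
  and \<gamma> are fixed by the swap of d and d + 1, while the sign changes; so the value is its own
  negative.\<close>

lemma Katalan_straighten_eq_0:
  assumes \<Psi>: "\<Psi> \<subseteq> pos_roots l" and d: "1 \<le> d" "d < l"
    and cols: "\<And>i. (i, d) \<in> \<Psi> \<longleftrightarrow> (i, Suc d) \<in> \<Psi>"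
    and rows: "\<And>j. (d, j) \<in> \<Psi> \<longleftrightarrow> (Suc d, j) \<in> \<Psi>"
    and M: "count M (Suc d) = Suc (count M d)"
    and \<gamma>: "\<gamma> (Suc d) = \<gamma> d + 1"
  shows "Katalan l \<Psi> M \<gamma> = 0"
proof -
  let ?s = "transpose d (Suc d)"
  define F where "F \<gamma> = raise_inv_prod \<Psi> (gsym l) \<gamma> -
    raise_inv_prod \<Psi> (gsym l) (\<lambda>m. \<gamma> m - eps (Suc d) m)" for \<gamma>
  define M' where "M' = M - {#Suc d#}"
  have M': "M = add_mset (Suc d) M'"
    using M by (simp add: M'_def count_greater_zero_iff[symmetric])
  have "image_mset ?s M' = M'"
  proof (rule multiset_eqI)
    fix m
    have "?s -` {m} = {?s m}" by (auto simp: transpose_eq_iff)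
    then have "count (image_mset ?s M') m = count M' (?s m)"
      by (cases "?s m \<in># M'") (auto simp: count_image_mset not_in_iff)
    also have "\<dots> = count M' m" using M by (auto simp: M'_def transpose_def)
    finally show "count (image_mset ?s M') m = count M' m" .
  qed
  moreover have "swap_index d \<gamma> = \<gamma>"
    using \<gamma> by (auto simp: swap_index_def eps_def transpose_def)
  moreover have "swap_root d \<alpha> \<in> \<Psi>" if "\<alpha> \<in> \<Psi>" for \<alpha>
  proof -
    \<comment> \<open>The swap would send (d, d + 1) outside the positive roots; \<open>cols\<close>
      excludes it because (d, d) is no root.\<close>
    have "(d, Suc d) \<notin> \<Psi>" "(Suc d, d) \<notin> \<Psi>" "(d, d) \<notin> \<Psi>" "(Suc d, Suc d) \<notin> \<Psi>"
      using cols[of d] \<Psi> by (auto simp: pos_roots_def)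
    then show ?thesis
      using that cols rows by (cases \<alpha>) (auto simp: transpose_def)
  qed
  then have "F (swap_index d \<gamma>) = - F \<gamma>" for \<gamma>
    unfolding F_def by (intro raise_inv_prod_diff_swap_index[OF \<Psi> _ d])
  ultimately have "lower_prod M' F \<gamma> = - lower_prod M' F \<gamma>"
    using lower_prod_swap_index[of M' F d \<gamma>] by (simp add: lower_prod_uminus)
  then show ?thesis
    unfolding Katalan_def M' lower_prod_add_mset' F_def[symmetric] by (simp only: powser_eq_uminus_iff)
qed

subsection \<open>The mirror lemma\<close>

text \<open>
  A bounce path ending in \<open>d\<close>: the columns \<open>p, p + 1\<close> agree at its top vertex, and below each
  inner vertex \<open>x\<close> the rows \<open>x, x + 1\<close> agree up to a shift of their first root by one.
\<close>

inductive mirror_path ::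
  "(nat \<times> nat) set \<Rightarrow> nat multiset \<Rightarrow> vec_index \<Rightarrow> nat \<Rightarrow> bool" for \<Psi> M \<gamma> where
  ceiling: "mirror_path \<Psi> M \<gamma> d"
    if "1 \<le> d" "\<And>i. i < d \<Longrightarrow> (i, d) \<in> \<Psi> \<longleftrightarrow> (i, Suc d) \<in> \<Psi>"
      "count M (Suc d) = Suc (count M d)"
| mirror: "mirror_path \<Psi> M \<gamma> d"
    if "mirror_path \<Psi> M \<gamma> x" "Suc x < d"
      "(x, d) \<in> \<Psi>" "(Suc x, d) \<notin> \<Psi>" "(Suc x, Suc d) \<in> \<Psi>"
      "\<And>i. i < d \<Longrightarrow> i \<noteq> Suc x \<Longrightarrow> (i, d) \<in> \<Psi> \<longleftrightarrow> (i, Suc d) \<in> \<Psi>"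
      "\<And>j. j \<noteq> d \<Longrightarrow> (x, j) \<in> \<Psi> \<longleftrightarrow> (Suc x, j) \<in> \<Psi>"
      "\<gamma> (Suc x) = \<gamma> x"
      "count M (Suc d) = Suc (count M d)"

text \<open>The conditions on a path ending in d concern only rows and entries before d, so changes
  from d on are harmless.\<close>

lemma mirror_path_cong:
  assumes "mirror_path \<Psi> M \<gamma> d"
    and "\<And>i j. i < d \<Longrightarrow> (i, j) \<in> \<Psi>' \<longleftrightarrow> (i, j) \<in> \<Psi>" "\<And>i. i < d \<Longrightarrow> \<gamma>' i = \<gamma> i"
  shows "mirror_path \<Psi>' M \<gamma>' d"
  using assms
proof (induction rule: mirror_path.induct)
  case (ceiling d)
  then show ?case by (intro mirror_path.ceiling) auto
next
  case (mirror x d)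
  show ?case
    by (rule mirror_path.mirror[of _ _ _ x]) (use mirror in auto)
qed

text \<open>Induction up the path: straightening settles the ceiling, and at a mirror vertex two
  root expansions carry the claim from d to the previous vertex x.\<close>

lemma Katalan_mirror_eq_0:
  assumes "mirror_path \<Psi> M \<gamma> d" "\<Psi> \<subseteq> pos_roots l" "d < l"
    and "\<And>j. (d, j) \<in> \<Psi> \<longleftrightarrow> (Suc d, j) \<in> \<Psi>" "\<gamma> (Suc d) = \<gamma> d + 1"
  shows "Katalan l \<Psi> M \<gamma> = 0"
  using assms
proof (induction d arbitrary: \<Psi> \<gamma> rule: less_induct)
  case (less d)
  note \<Psi> = \<open>\<Psi> \<subseteq> pos_roots l\<close> and rows = less.prems(4)
  \<comment> \<open>(d, d + 1) would force (d + 1, d + 1) into \<Psi>; hence columns d and d + 1 are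
    empty from row d on.\<close>
  have no: "(i, d) \<notin> \<Psi>" "(i, Suc d) \<notin> \<Psi>" if "\<not> i < d" for i
    using \<Psi> rows[of "Suc d"] that by (cases "i = d"; auto simp: pos_roots_def)+
  from \<open>mirror_path \<Psi> M \<gamma> d\<close> show ?case
  proof cases
    case ceiling
    show ?thesis
      by (rule Katalan_straighten_eq_0[OF \<Psi> _ less.prems(3)]) (use ceiling less.prems no in blast)+
  next
    case (mirror x)
    \<comment> \<open>Without \<open>?a\<close>, and also with \<open>?b\<close> added, \<open>\<Psi>\<close> is symmetric at \<open>d\<close>, so straightening
      applies; with \<open>?b\<close> added, the path may moreover be cut at \<open>x\<close>.\<close>
    let ?a = "(Suc x, Suc d)" and ?b = "(Suc x, d)"
    let ?g1 = "\<lambda>m. \<gamma> m + eps (Suc x) m - eps (Suc d) m"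
    let ?g2 = "\<lambda>m. ?g1 m + eps (Suc x) m - eps d m"
    let ?P = "insert ?b \<Psi>"
    have P: "?P \<subseteq> pos_roots l" using \<Psi> mirror less.prems(3) by (auto simp: pos_roots_def)
    have "Katalan l \<Psi> M \<gamma> = Katalan l (\<Psi> - {?a}) M \<gamma> + Katalan l \<Psi> M ?g1"
      by (rule Katalan_remove_root) (use \<Psi> mirror in auto)
    moreover have "Katalan l (\<Psi> - {?a}) M \<gamma> = 0"
    proof (rule Katalan_straighten_eq_0)
      fix i show "(i, d) \<in> \<Psi> - {?a} \<longleftrightarrow> (i, Suc d) \<in> \<Psi> - {?a}"
        using mirror no[of i] by (cases "i < d") auto
    qed (use \<Psi> mirror less.prems in auto)
    moreover have "Katalan l ?P M ?g1 = Katalan l (?P - {?b}) M ?g1 + Katalan l ?P M ?g2"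
      by (rule Katalan_remove_root) (use P in auto)
    moreover have "?P - {?b} = \<Psi>" using mirror by auto
    moreover have "Katalan l ?P M ?g2 = 0"
    proof (rule Katalan_straighten_eq_0)
      fix i show "(i, d) \<in> ?P \<longleftrightarrow> (i, Suc d) \<in> ?P"
        using mirror no[of i] by (cases "i < d") auto
    qed (use P mirror less.prems in \<open>auto simp: eps_def\<close>)
    \<comment> \<open>\<open>?g1\<close> raises entry x + 1, so the equal entries at x and x + 1
      become the ascent by one that the induction hypothesis asks for.\<close>
    moreover have "Katalan l ?P M ?g1 = 0"
    proof (rule less.IH)
      show "mirror_path ?P M ?g1 x"
        by (rule mirror_path_cong[OF mirror(1)]) (use mirror in \<open>auto simp: eps_def\<close>)
      fix j show "(x, j) \<in> ?P \<longleftrightarrow> (Suc x, j) \<in> ?P" using mirror by (cases "j = d") auto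
    qed (use P mirror less.prems in \<open>auto simp: eps_def\<close>)
    ultimately show ?thesis by simp
  qed
qed

subsection \<open>Trailing zeros\<close>

lemma raise_index_last:
  assumes "\<Psi> \<subseteq> pos_roots l"
  shows "raise_index \<Psi> n \<gamma> l \<le> \<gamma> l"
proof -
  have "(\<Sum>(i, j)\<in>\<Psi>. int (n (i, j)) * (eps i l - eps j l)) \<le> 0"
    by (rule sum_nonpos) (use assms in \<open>auto simp: pos_roots_def eps_def\<close>)
  then show ?thesis by (simp add: raise_index_def)
qed

text \<open>Neither raising nor lowering can increase the last entry, and a negative one makes the
  last row of every determinant vanish.\<close>

lemma Katalan_last_neg_eq_0:
  assumes "\<Psi> \<subseteq> pos_roots l" "1 \<le> l" "\<gamma> l < 0"
  shows "Katalan l \<Psi> M \<gamma> = 0"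
  unfolding Katalan_def using \<open>\<gamma> l < 0\<close>
proof (induction M arbitrary: \<gamma>)
  case empty
  have "gsym l (raise_index \<Psi> n \<gamma>) = 0" for n
    using raise_index_last[OF assms(1), of n \<gamma>] empty assms(2) by (intro gsym_eq_0[of l]) auto
  then show ?case by (simp add: raise_inv_prod_def)
next
  case (add z M)
  have "\<gamma> l - eps z l < 0" using add.prems by (auto simp: eps_def)
  with add show ?case by (simp add: lower_prod_add_mset)
qed

lemma gsym_Suc:
  assumes "\<gamma> (Suc l) = 0"
  shows "gsym (Suc l) \<gamma> = gsym l \<gamma>"
proof -
  let ?A = "mat (Suc l) (Suc l) (\<lambda>(i, j). ksym i (\<gamma> (Suc i) + int j - int i))"
  have "hsym 0 = 1" by transfer auto
  then have row: "?A $$ (l, j) = (if j = l then 1 else 0)" if "j < Suc l" for j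
    using assms that by (auto simp: ksym_def)
  have del: "mat_delete ?A l l = mat l l (\<lambda>(i, j). ksym i (\<gamma> (Suc i) + int j - int i))"
    by (rule eq_matI) (auto simp: mat_delete_def)
  have "det ?A = (\<Sum>j<Suc l. ?A $$ (l, j) * cofactor ?A l j)"
    by (rule laplace_expansion_row) auto
  also have "\<dots> = (\<Sum>j<Suc l. if j = l then cofactor ?A l l else 0)"
    by (rule sum.cong) (use row in auto)
  also have "\<dots> = det (mat_delete ?A l l)"
    by (simp add: cofactor_def)
  finally show ?thesis by (simp add: gsym_def del)
qed

text \<open>Each term that uses a root or a lowering in column l + 1 has a negative last entry and
  vanishes. Roots are stripped one at a time, lowerings by induction on \<open>M\<close>; then
  \<open>gsym_Suc\<close> applies.\<close>

lemma Katalan_Suc: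
  assumes \<Psi>: "\<Psi> \<subseteq> pos_roots (Suc l)" and \<gamma>: "\<gamma> (Suc l) = 0"
  shows "Katalan (Suc l) \<Psi> M \<gamma> = Katalan l (\<Psi> \<inter> pos_roots l) {#j \<in># M. j \<noteq> Suc l#} \<gamma>"
proof -
  let ?P = "\<Psi> \<inter> pos_roots l"
  have "Katalan (Suc l) \<Psi> M \<gamma> = Katalan (Suc l) (\<Psi> - A) M \<gamma>" if "A \<subseteq> \<Psi> - ?P" for A
  proof -
    have "finite A" using finite_root_set[OF \<Psi>] that by (meson Diff_subset finite_subset)
    then show ?thesis using that
    proof (induction A)
      case (insert \<alpha> A)
      then obtain i where i: "\<alpha> = (i, Suc l)" "i < Suc l"
        using \<Psi> by (cases \<alpha>) (auto simp: pos_roots_def le_Suc_eq)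
      have sub: "\<Psi> - A \<subseteq> pos_roots (Suc l)" using \<Psi> by auto
      have "Katalan (Suc l) (\<Psi> - A) M \<gamma> = Katalan (Suc l) (\<Psi> - A - {\<alpha>}) M \<gamma> +
          Katalan (Suc l) (\<Psi> - A) M (\<lambda>m. \<gamma> m + eps i m - eps (Suc l) m)"
        unfolding i by (rule Katalan_remove_root) (use sub insert i in auto)
      also have "Katalan (Suc l) (\<Psi> - A) M (\<lambda>m. \<gamma> m + eps i m - eps (Suc l) m) = 0"
        by (rule Katalan_last_neg_eq_0) (use sub i \<gamma> in \<open>auto simp: eps_def\<close>)
      also have "\<Psi> - A - {\<alpha>} = \<Psi> - insert \<alpha> A" by auto
      finally show ?case using insert by simp
    qed simp
  qed
  from this[of "\<Psi> - ?P"] have "Katalan (Suc l) \<Psi> M \<gamma> = Katalan (Suc l) ?P M \<gamma>"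
    by (simp add: Diff_Diff_Int)
  also have "\<dots> = Katalan l ?P {#j \<in># M. j \<noteq> Suc l#} \<gamma>"
    using \<gamma>
  proof (induction M arbitrary: \<gamma>)
    case empty
    have "raise_index ?P n \<gamma> (Suc l) = 0" for n
    proof -
      have "(\<Sum>(i, j)\<in>?P. int (n (i, j)) * (eps i (Suc l) - eps j (Suc l))) = 0"
        by (rule sum.neutral) (auto simp: pos_roots_def eps_def)
      with empty show ?thesis by (simp add: raise_index_def)
    qed
    then have "gsym (Suc l) (raise_index ?P n \<gamma>) = gsym l (raise_index ?P n \<gamma>)" for n
      by (rule gsym_Suc)
    then show ?case by (simp add: Katalan_def raise_inv_prod_def)
  next
    case (add z M)
    show ?case
    proof (cases "z = Suc l")
      case True
      have "Katalan (Suc l) ?P M (\<lambda>i. \<gamma> i - eps z i) = 0"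
        by (rule Katalan_last_neg_eq_0) (use True add.prems in \<open>auto simp: eps_def pos_roots_def\<close>)
      with add True show ?thesis by (simp add: Katalan_add_mset)
    next
      case False
      with add show ?thesis by (simp add: Katalan_add_mset eps_def)
    qed
  qed
  finally show ?thesis .
qed

lemma Delta_subset_pos_roots: "Delta k l lam \<subseteq> pos_roots l"
  by (auto simp: Delta_def)

lemma Katalan_Delta_eq_KkSchur:
  assumes "\<mu> \<in> bounded_partitions_len k l"
  shows "Katalan l (Delta k l \<mu>) (Lmset (Delta (k + 1) l \<mu>)) \<mu> = KkSchur k \<mu>"
  using assms
proof (induction l)
  case 0
  then have "\<mu> i = 0" for i by (auto simp: bounded_partitions_len_def)
  then show ?case by (simp add: KkSchur_def part_length_def)
next
  case (Suc l)
  show ?case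
  proof (cases "\<mu> (Suc l) = 0")
    case True
    then have \<mu>: "\<mu> \<in> bounded_partitions_len k l"
      using Suc.prems by (auto simp: bounded_partitions_len_def le_Suc_eq)
    have D: "Delta q (Suc l) \<mu> \<inter> pos_roots l = Delta q l \<mu>" for q
      by (auto simp: Delta_def pos_roots_def)
    have "{#j \<in># Lmset (Delta (k + 1) (Suc l) \<mu>). j \<noteq> Suc l#} =
        image_mset snd {#\<alpha> \<in># mset_set (Delta (k + 1) (Suc l) \<mu>). snd \<alpha> \<noteq> Suc l#}"
      by (simp add: Lmset_def filter_mset_image_mset comp_def)
    also have "\<dots> = Lmset {\<alpha> \<in> Delta (k + 1) (Suc l) \<mu>. snd \<alpha> \<noteq> Suc l}"
      using finite_root_set[OF Delta_subset_pos_roots] by (simp add: Lmset_def filter_mset_mset_set)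
    also have "{\<alpha> \<in> Delta (k + 1) (Suc l) \<mu>. snd \<alpha> \<noteq> Suc l} = Delta (k + 1) l \<mu>"
      by (auto simp: Delta_def pos_roots_def)
    finally show ?thesis
      using Suc.IH[OF \<mu>] Katalan_Suc[of "Delta k (Suc l) \<mu>" l \<mu>, OF Delta_subset_pos_roots True]
      by (simp add: D)
  next
    case False
    have "\<mu> i \<noteq> 0 \<longleftrightarrow> i \<in> {1..Suc l}" for i
      using bounded_partitions_len_antimono[OF Suc.prems, of i "Suc l"] False Suc.prems
      by (force simp: bounded_partitions_len_def)
    then have "{i. \<mu> i \<noteq> 0} = {1..Suc l}" by blast
    then have "part_length \<mu> = Suc l" by (simp add: part_length_def)
    then show ?thesis by (simp add: KkSchur_def)
  qed
qed

subsection \<open>Lowering along a bounce path\<close>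

text \<open>A total version of \<open>down\<close>: for a k-bounded partition it exceeds l in
  exactly those rows i \<ge> 1 that have no root.\<close>

definition down_row :: "nat \<Rightarrow> vec_index \<Rightarrow> nat \<Rightarrow> nat" where
  "down_row k lam i = nat (int k - lam i + int i + 1)"

text \<open>
  The second coordinates of these roots form the multiset in the definition of the weighted
  function: in the rows from \<open>z\<close> on, the first root is dropped.
\<close>

definition lowering_roots :: "nat \<Rightarrow> nat \<Rightarrow> nat \<Rightarrow> vec_index \<Rightarrow> (nat \<times> nat) set" where
  "lowering_roots k l z lam =
     {(i, j) \<in> pos_roots l. int k - lam i + int i + (if i < z then 0 else 1) < int j}"

text \<open>The index \<gamma> is kept apart from \<open>lam\<close> so that it can be lowered while
  the root ideal and the multiset stay fixed.\<close>

definition wKat :: "nat \<Rightarrow> nat \<Rightarrow> nat \<Rightarrow> vec_index \<Rightarrow> vec_index \<Rightarrow> powser" where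
  "wKat k l z lam \<gamma> = Katalan l (Delta k l lam) (Lmset (lowering_roots k l z lam)) \<gamma>"

lemma bounded_partitions_len_le: "lam \<in> bounded_partitions_len k l \<Longrightarrow> lam i \<le> int k"
  by (cases "i \<in> {1..l}") (auto simp: bounded_partitions_len_def)

lemma bounded_partitions_len_mono:
  assumes "lam \<in> bounded_partitions_len k l" "1 \<le> i" "i \<le> j"
  shows "lam j \<le> lam i"
proof (cases "j \<le> l")
  case True
  then show ?thesis using bounded_partitions_len_antimono assms by blast
next
  case False
  then have "lam j = 0" using assms by (auto simp: bounded_partitions_len_def)
  then show ?thesis using assms by (cases "i \<le> l") (auto simp: bounded_partitions_len_def)
qed

lemma int_down_row:
  "lam \<in> bounded_partitions_len k l \<Longrightarrow> int (down_row k lam i) = int k - lam i + int i + 1"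
  using bounded_partitions_len_le[of lam k l i] by (simp add: down_row_def)

lemma down_row_gt: "lam \<in> bounded_partitions_len k l \<Longrightarrow> i < down_row k lam i"
  using int_down_row[of lam k l i] bounded_partitions_len_le[of lam k l i] by linarith

lemma down_row_diff:
  assumes "lam \<in> bounded_partitions_len k l" "1 \<le> i" "i \<le> j"
  shows "down_row k lam i + (j - i) \<le> down_row k lam j"
  using int_down_row[OF assms(1), of i] int_down_row[OF assms(1), of j]
    bounded_partitions_len_mono[OF assms] assms(3) by linarith

lemma down_row_Suc:
  assumes "lam \<in> bounded_partitions_len k l"
  shows "int (down_row k lam (Suc i)) = int (down_row k lam i) + 1 + (lam i - lam (Suc i))"
  using int_down_row[OF assms] by simp

lemma mem_Delta_iff:
  assumes "lam \<in> bounded_partitions_len k l"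
  shows "(i, j) \<in> Delta k l lam \<longleftrightarrow> 1 \<le> i \<and> j \<le> l \<and> down_row k lam i \<le> j"
  using int_down_row[OF assms, of i] down_row_gt[OF assms, of i]
  by (auto simp: Delta_def pos_roots_def)

lemma mem_lowering_roots_iff:
  assumes "lam \<in> bounded_partitions_len k l"
  shows "(i, j) \<in> lowering_roots k l z lam \<longleftrightarrow>
    1 \<le> i \<and> j \<le> l \<and> (if i < z then down_row k lam i \<le> j else down_row k lam i < j)"
  using int_down_row[OF assms, of i] down_row_gt[OF assms, of i]
  by (auto simp: lowering_roots_def pos_roots_def)

lemma lowering_roots_subset: "lowering_roots k l z lam \<subseteq> pos_roots l"
  by (auto simp: lowering_roots_def)

lemma count_Lmset:
  assumes "finite A"
  shows "count (Lmset A) j = card {i. (i, j) \<in> A}"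
proof -
  have "count (Lmset A) j = (\<Sum>\<alpha>\<in>snd -` {j} \<inter> A. 1)"
    unfolding Lmset_def count_image_mset using assms by (intro sum.cong) auto
  also have "\<dots> = card (snd -` {j} \<inter> A)" by simp
  also have "snd -` {j} \<inter> A = (\<lambda>i. (i, j)) ` {i. (i, j) \<in> A}" by force
  also have "card \<dots> = card {i. (i, j) \<in> A}" by (rule card_image) (simp add: inj_on_def)
  finally show ?thesis .
qed

lemma Lmset_insert:
  "finite A \<Longrightarrow> (i, j) \<notin> A \<Longrightarrow> Lmset (insert (i, j) A) = add_mset j (Lmset A)"
  by (simp add: Lmset_def)

text \<open>Row p has lost its first root, so it misses column dn(p) but meets the next one; rows
  above meet both, rows below neither. This is the multiplicity jump that straightening
  demands.\<close>

lemma count_Lmset_lowering_roots: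
  assumes lam: "lam \<in> bounded_partitions_len k l" and p: "1 \<le> p" "z \<le> p" and l: "down_row k lam p < l"
  shows "count (Lmset (lowering_roots k l z lam)) (down_row k lam p) = p - 1"
    and "count (Lmset (lowering_roots k l z lam)) (Suc (down_row k lam p)) = p"
proof -
  have mono: "down_row k lam i < down_row k lam j" if "1 \<le> i" "i < j" for i j
    using down_row_diff[OF lam, of i j] that by simp
  have "{i. (i, down_row k lam p) \<in> lowering_roots k l z lam} = {1..p - 1}"
  proof (rule Set.set_eqI)
    fix i
    consider "i = 0" | "1 \<le> i" "i < p" | "i = p" | "p < i" by linarith
    then show "i \<in> {i. (i, down_row k lam p) \<in> lowering_roots k l z lam} \<longleftrightarrow> i \<in> {1..p - 1}"
      by cases (use p l mono[of i p] mono[of p i] in \<open>auto simp: mem_lowering_roots_iff[OF lam]\<close>)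
  qed
  moreover have "{i. (i, Suc (down_row k lam p)) \<in> lowering_roots k l z lam} = {1..p}"
  proof (rule Set.set_eqI)
    fix i
    consider "i = 0" | "1 \<le> i" "i < p" | "i = p" | "p < i" by linarith
    then show "i \<in> {i. (i, Suc (down_row k lam p)) \<in> lowering_roots k l z lam} \<longleftrightarrow> i \<in> {1..p}"
      by cases (use p l mono[of i p] mono[of p i] in \<open>auto simp: mem_lowering_roots_iff[OF lam]\<close>)
  qed
  ultimately show "count (Lmset (lowering_roots k l z lam)) (down_row k lam p) = p - 1"
    "count (Lmset (lowering_roots k l z lam)) (Suc (down_row k lam p)) = p"
    by (simp_all add: count_Lmset[OF finite_root_set[OF lowering_roots_subset]])
qed

text \<open>
  Going up the bounce path from \<open>p\<close> through rows with \<open>lam i = lam (i + 1)\<close>, one meets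
  a strict descent at some row \<open>\<ge> z\<close>.
\<close>

inductive anchored :: "nat \<Rightarrow> nat \<Rightarrow> vec_index \<Rightarrow> nat \<Rightarrow> bool" for k z lam where
  descent: "anchored k z lam p" if "1 \<le> p" "z \<le> p" "lam (Suc p) < lam p"
| bounce: "anchored k z lam (down_row k lam p)"
    if "anchored k z lam p" "lam (Suc (down_row k lam p)) = lam (down_row k lam p)"

text \<open>The bound by k passes down the path by monotonicity; it makes a bounce from a flat row
  advance by at least two, as \<open>mirror_path\<close> requires.\<close>

lemma anchoredD:
  assumes "anchored k z lam p" "lam \<in> bounded_partitions_len k l"
  shows "1 \<le> p \<and> z \<le> p \<and> lam (Suc p) < int k"
  using assms
proof (induction rule: anchored.induct)
  case (descent p)
  then show ?case using bounded_partitions_len_le[of lam k l p] by simp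
next
  case (bounce p)
  then show ?case
    using down_row_gt[of lam k l p] bounded_partitions_len_mono[of lam k l "Suc p" "down_row k lam p"]
    by auto
qed

text \<open>After a descent at p the first columns of rows p and p + 1 differ by at least two, so
  columns dn(p) and dn(p) + 1 agree: a ceiling. In a flat row they differ by exactly one: a
  mirror.\<close>

lemma anchored_mirror_path:
  assumes "anchored k z lam p" and lam: "lam \<in> bounded_partitions_len k l"
    and "down_row k lam p < l"
  shows "mirror_path (Delta k l lam) (Lmset (lowering_roots k l z lam)) lam (down_row k lam p)"
  using assms(1,3)
proof (induction rule: anchored.induct)
  case (descent p)
  let ?d = "down_row k lam p"
  have gap: "?d + 1 < down_row k lam (Suc p)"
    using down_row_Suc[OF lam, of p] descent by linarith
  show ?case
  proof (rule mirror_path.ceiling)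
    fix i
    show "(i, ?d) \<in> Delta k l lam \<longleftrightarrow> (i, Suc ?d) \<in> Delta k l lam"
    proof (cases "i \<le> p")
      case True
      then show ?thesis
        using down_row_diff[OF lam, of i p] descent by (auto simp: mem_Delta_iff[OF lam])
    next
      case False
      then show ?thesis
        using down_row_diff[OF lam, of "Suc p" i] gap by (auto simp: mem_Delta_iff[OF lam])
    qed
  qed (use descent count_Lmset_lowering_roots[OF lam, of p z] down_row_gt[OF lam, of p] in auto)
next
  case (bounce p)
  let ?x = "down_row k lam p"
  let ?d = "down_row k lam ?x"
  have p: "1 \<le> p" "z \<le> p" using anchoredD[OF bounce(1) lam] by auto
  have px: "p < ?x" by (rule down_row_gt[OF lam])
  have xd: "Suc ?x < ?d"
    using int_down_row[OF lam, of ?x] anchoredD[OF anchored.bounce[OF bounce(1,2)] lam] bounce(2)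
    by linarith
  have sx: "down_row k lam (Suc ?x) = Suc ?d"
    using down_row_Suc[OF lam, of ?x] bounce(2) by linarith
  show ?case
  proof (rule mirror_path.mirror[of _ _ _ ?x])
    show "mirror_path (Delta k l lam) (Lmset (lowering_roots k l z lam)) lam ?x"
      using bounce xd by auto
    fix i assume "i \<noteq> Suc ?x"
    then consider "i = 0" | "1 \<le> i" "i \<le> ?x" | "Suc ?x < i" by linarith
    then show "(i, ?d) \<in> Delta k l lam \<longleftrightarrow> (i, Suc ?d) \<in> Delta k l lam"
      by cases (use down_row_diff[OF lam, of i ?x] down_row_diff[OF lam, of "Suc ?x" i] sx bounce
          in \<open>auto simp: mem_Delta_iff[OF lam]\<close>)
  qed (use p px xd sx bounce count_Lmset_lowering_roots[OF lam, of ?x z]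
      in \<open>auto simp: mem_Delta_iff[OF lam]\<close>)
qed

text \<open>
  Applies \<open>1 - L\<close> in column \<open>down_row k lam p\<close>; beyond column \<open>l\<close> the operator
  \<open>L\<close> counts as \<open>0\<close>, in accordance with padding by zeros.
\<close>

definition lowered :: "nat \<Rightarrow> nat \<Rightarrow> nat \<Rightarrow> vec_index \<Rightarrow> nat \<Rightarrow> powser" where
  "lowered k l z lam p = wKat k l z lam lam -
     (if down_row k lam p \<le> l then wKat k l z lam (\<lambda>m. lam m - eps (down_row k lam p) m) else 0)"

text \<open>Raising along (d, dn(d)) cancels the lowering at d and leaves one at dn(d). If dn(d)
  exceeds l, no root is removed.\<close>

lemma wKat_remove_root:
  assumes lam: "lam \<in> bounded_partitions_len k l" and d: "1 \<le> d"
  shows "wKat k l z lam (\<lambda>m. lam m - eps d m) =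
    Katalan l (Delta k l lam - {(d, down_row k lam d)}) (Lmset (lowering_roots k l z lam))
      (\<lambda>m. lam m - eps d m) +
    (if down_row k lam d \<le> l then wKat k l z lam (\<lambda>m. lam m - eps (down_row k lam d) m) else 0)"
proof (cases "down_row k lam d \<le> l")
  case True
  have "(\<lambda>m. lam m - eps d m + eps d m - eps (down_row k lam d) m) =
        (\<lambda>m. lam m - eps (down_row k lam d) m)" by auto
  then show ?thesis
    using True d Katalan_remove_root[OF Delta_subset_pos_roots, of d "down_row k lam d" k l lam
        "Lmset (lowering_roots k l z lam)" "\<lambda>m. lam m - eps d m"]
    by (simp add: wKat_def mem_Delta_iff[OF lam])
next
  case False
  then have "Delta k l lam - {(d, down_row k lam d)} = Delta k l lam"
    by (auto simp: mem_Delta_iff[OF lam])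
  with False show ?thesis by (simp add: wKat_def)
qed

text \<open>The term without the root (d, dn(d)) vanishes: rows d and d + 1 then agree and the
  lowered entry d is one less than the next, so the mirror lemma applies. For d = l, flatness means
  \<open>lam l = 0\<close>, and the last entry becomes negative.\<close>

lemma lowered_flat:
  assumes lam: "lam \<in> bounded_partitions_len k l"
    and d: "d = down_row k lam p" "d \<le> l" "lam (Suc d) = lam d"
    and anch: "anchored k z lam p \<or> l \<le> d"
  shows "lowered k l z lam p = lowered k l z lam d"
proof -
  let ?e = "down_row k lam d" and ?M = "Lmset (lowering_roots k l z lam)"
  have d1: "1 \<le> d" using down_row_gt[OF lam, of p] d by simp
  have "Katalan l (Delta k l lam - {(d, ?e)}) ?M (\<lambda>m. lam m - eps d m) = 0"
  proof (cases "d = l")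
    case True
    have "lam (Suc l) = 0" using lam by (auto simp: bounded_partitions_len_def)
    then show ?thesis
      using True d d1 by (intro Katalan_last_neg_eq_0) (auto simp: eps_def Delta_def)
  next
    case False
    then have dl: "d < l" and p: "anchored k z lam p" using d anch by auto
    have e: "down_row k lam (Suc d) = Suc ?e"
      using down_row_Suc[OF lam, of d] d by linarith
    show ?thesis
    proof (rule Katalan_mirror_eq_0)
      show "mirror_path (Delta k l lam - {(d, ?e)}) ?M (\<lambda>m. lam m - eps d m) d"
        by (rule mirror_path_cong[OF anchored_mirror_path[OF p lam, folded d(1), OF dl]])
          (auto simp: eps_def)
      show "(d, j) \<in> Delta k l lam - {(d, ?e)} \<longleftrightarrow> (Suc d, j) \<in> Delta k l lam - {(d, ?e)}" for j
        using e d1 by (auto simp: mem_Delta_iff[OF lam])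
    qed (use dl d in \<open>auto simp: eps_def Delta_def\<close>)
  qed
  then show ?thesis
    using d wKat_remove_root[OF lam d1, of z] by (simp add: lowered_def)
qed

lemma bounded_partitions_len_lower:
  assumes lam: "lam \<in> bounded_partitions_len k l" and d: "1 \<le> d" "d \<le> l" "lam (Suc d) < lam d"
  shows "(\<lambda>m. lam m - eps d m) \<in> bounded_partitions_len k l"
proof -
  have "0 \<le> lam (Suc d)"
    using lam by (cases "Suc d \<le> l") (auto simp: bounded_partitions_len_def)
  moreover have "lam d - 1 \<le> int k" using bounded_partitions_len_le[OF lam, of d] by simp
  ultimately show ?thesis
    using assms
    by (auto simp: bounded_partitions_len_def eps_def)
qed

text \<open>Removing (d, dn(d)) yields the ideal of the partition lowered at d, whose first column
  in row d is dn(d) + 1. As d \<ge> z, the old multiset has a surplus copy of that column (if it is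
  at most l), which supplies the factor 1 - L of \<open>lowered\<close>.\<close>

lemma lowered_descent:
  assumes lam: "lam \<in> bounded_partitions_len k l"
    and d: "d = down_row k lam p" "d \<le> l" "lam (Suc d) < lam d" "z \<le> d"
  shows "lowered k l z lam p = lowered k l z lam d - lowered k l z (\<lambda>m. lam m - eps d m) d"
proof -
  let ?e = "down_row k lam d" and ?lam = "\<lambda>m. lam m - eps d m"
  let ?M = "Lmset (lowering_roots k l z lam)"
  have d1: "1 \<le> d" using down_row_gt[OF lam, of p] d by simp
  have lam': "?lam \<in> bounded_partitions_len k l"
    using bounded_partitions_len_lower[OF lam d1 d(2,3)] .
  have rows: "down_row k ?lam i = (if i = d then Suc ?e else down_row k lam i)" for i
    using int_down_row[OF lam, of i] int_down_row[OF lam', of i] by (auto simp: eps_def)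
  have D: "Delta k l ?lam = Delta k l lam - {(d, ?e)}"
    by (auto simp: mem_Delta_iff[OF lam] mem_Delta_iff[OF lam'] rows split: if_splits)
  have R: "lowering_roots k l z ?lam = lowering_roots k l z lam - {(d, Suc ?e)}"
    using d(4)
    by (auto simp: mem_lowering_roots_iff[OF lam] mem_lowering_roots_iff[OF lam'] rows
        split: if_splits)
  have "Katalan l (Delta k l lam - {(d, ?e)}) ?M ?lam = lowered k l z ?lam d"
  proof (cases "Suc ?e \<le> l")
    case True
    then have "lowering_roots k l z lam = insert (d, Suc ?e) (lowering_roots k l z ?lam)"
      using d1 d(4) unfolding R by (auto simp: mem_lowering_roots_iff[OF lam])
    moreover have "(d, Suc ?e) \<notin> lowering_roots k l z ?lam" unfolding R by simp
    ultimately have "?M = add_mset (Suc ?e) (Lmset (lowering_roots k l z ?lam))"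
      using Lmset_insert[OF finite_root_set[OF lowering_roots_subset]] by metis
    then show ?thesis
      using True by (simp add: lowered_def wKat_def D rows Katalan_add_mset)
  next
    case False
    then have "lowering_roots k l z ?lam = lowering_roots k l z lam"
      unfolding R by (auto simp: mem_lowering_roots_iff[OF lam])
    then show ?thesis
      using False by (simp add: lowered_def wKat_def D rows)
  qed
  then show ?thesis
    using d wKat_remove_root[OF lam d1, of z] by (simp add: lowered_def)
qed

text \<open>Only the end of the path can be touched: if d = p + 1 and p was flat, p becomes a
  descent and a path starts there.\<close>

lemma anchored_lower:
  assumes "anchored k z lam p" "p < d" and lam: "lam \<in> bounded_partitions_len k l"
  shows "anchored k z (\<lambda>m. lam m - eps d m) p"
  using assms(1,2)
proof (induction rule: anchored.induct)
  case (descent p)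
  then show ?case by (intro anchored.descent) (auto simp: eps_def)
next
  case (bounce p)
  let ?lam = "\<lambda>m. lam m - eps d m" and ?x = "down_row k lam p"
  have px: "p < ?x" by (rule down_row_gt[OF lam])
  show ?case
  proof (cases "Suc ?x = d")
    case True
    then show ?thesis
      using bounce anchoredD[OF bounce(1) lam] px by (intro anchored.descent) (auto simp: eps_def)
  next
    case False
    have x: "down_row k ?lam p = ?x" using px bounce.prems by (simp add: down_row_def eps_def)
    have "anchored k z ?lam (down_row k ?lam p)"
    proof (rule anchored.bounce)
      show "?lam (Suc (down_row k ?lam p)) = ?lam (down_row k ?lam p)"
        unfolding x using bounce.hyps bounce.prems False by (simp add: eps_def)
    qed (use bounce px in auto)
    then show ?thesis by (simp add: x)
  qed
qed

section \<open>Alternating expansions\<close>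

lemma part_size_eq_sum:
  "lam \<in> bounded_partitions_len k l \<Longrightarrow> part_size lam = (\<Sum>i = 1..l. lam i)"
  unfolding part_size_def by (rule sum.mono_neutral_left) (auto simp: bounded_partitions_len_def)

text \<open>Differences are the only combinations that the recursion produces; n is the size against
  which the signs are measured.\<close>

inductive alternating :: "nat \<Rightarrow> int \<Rightarrow> powser \<Rightarrow> bool" for k where
  KkSchur: "\<mu> \<in> bounded_partitions k \<Longrightarrow> alternating k (part_size \<mu>) (KkSchur k \<mu>)"
| diff: "alternating k n f \<Longrightarrow> alternating k (n - 1) g \<Longrightarrow> alternating k n (f - g)"

text \<open>A flat row passes the claim on to d, a descent splits it between \<open>lam\<close> and
  its lowering at d, and beyond column l only \<open>wKat\<close> is left. All lowered rows exceed
  z, so every partition met agrees with \<nu> up to z.\<close>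

lemma alternating_lowered:
  assumes "\<And>\<mu>. \<mu> \<in> bounded_partitions_len k l \<Longrightarrow> (\<And>i. i \<le> z \<Longrightarrow> \<mu> i = \<nu> i) \<Longrightarrow>
      alternating k (part_size \<mu>) (wKat k l z \<mu> \<mu>)"
    and "lam \<in> bounded_partitions_len k l" "\<And>i. i \<le> z \<Longrightarrow> lam i = \<nu> i"
    and "z \<le> p" "anchored k z lam p \<or> l \<le> down_row k lam p"
  shows "alternating k (part_size lam) (lowered k l z lam p)"
  using assms(2-)
proof (induction "l - p" arbitrary: p lam rule: less_induct)
  case less
  note lam = less.prems(1)
  define d where "d = down_row k lam p"
  have pd: "p < d" using down_row_gt[OF lam] by (simp add: d_def)
  show ?case
  proof (cases "d \<le> l")
    case False
    then show ?thesis using assms(1)[OF lam less.prems(2)] by (simp add: lowered_def d_def)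
  next
    case dl: True
    have "lam (Suc d) \<le> lam d" using bounded_partitions_len_mono[OF lam] pd by simp
    then consider "lam (Suc d) = lam d" | "lam (Suc d) < lam d" by linarith
    then show ?thesis
    proof cases
      case 1
      have "anchored k z lam d \<or> l \<le> down_row k lam d"
        using less.prems(4) 1 anchored.bounce[of k z lam p] down_row_gt[OF lam, of d]
        by (auto simp: d_def)
      then have "alternating k (part_size lam) (lowered k l z lam d)"
        using less.prems pd dl by (intro less.hyps) auto
      moreover have "lowered k l z lam p = lowered k l z lam d"
        by (rule lowered_flat) (use lam dl 1 less.prems(4) in \<open>auto simp: d_def\<close>)
      ultimately show ?thesis by simp
    next
      case 2
      let ?lam = "\<lambda>m. lam m - eps d m"
      have lam': "?lam \<in> bounded_partitions_len k l"
        using bounded_partitions_len_lower[OF lam] pd dl 2 by simp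
      have zd: "z < d" using less.prems(3) pd by simp
      have size: "part_size ?lam = part_size lam - 1"
        unfolding part_size_eq_sum[OF lam] part_size_eq_sum[OF lam'] using dl pd
        by (simp add: sum_subtractf eps_def)
      have "anchored k z lam d" using 2 zd by (intro anchored.descent) auto
      then have "alternating k (part_size lam) (lowered k l z lam d)"
        using less.prems pd dl by (intro less.hyps) auto
      \<comment> \<open>Row d of \<open>?lam\<close> is either still a descent or has become flat.
        In the flat case with d < l, the anchor at p survives the lowering and the path bounces on
        to d.\<close>
      moreover have "anchored k z ?lam d \<or> l \<le> down_row k ?lam d"
      proof (cases "lam (Suc d) < lam d - 1")
        case True
        then show ?thesis using zd by (auto simp: eps_def intro: anchored.descent)
      next
        case False
        then have flat: "?lam (Suc d) = ?lam d" using 2 by (simp add: eps_def)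
        have d': "d = down_row k ?lam p" using pd by (simp add: d_def down_row_def eps_def)
        show ?thesis
        proof (cases "d = l")
          case True
          then show ?thesis using down_row_gt[OF lam', of d] by simp
        next
          case False
          then have "anchored k z ?lam p"
            using less.prems(4) dl pd by (intro anchored_lower[OF _ _ lam]) (auto simp: d_def)
          then show ?thesis using anchored.bounce[of k z ?lam p] flat d' by simp
        qed
      qed
      then have "alternating k (part_size lam - 1) (lowered k l z ?lam d)"
        unfolding size[symmetric]
        using less.prems(2,3) pd dl lam' by (intro less.hyps) (auto simp: eps_def)
      ultimately have "alternating k (part_size lam) (lowered k l z lam d - lowered k l z ?lam d)"
        by (rule alternating.diff)
      then show ?thesis
        using lowered_descent[OF lam d_def dl 2] zd by simp
    qed
  qed
qed

text \<open>Increasing z by one in \<open>wKat\<close> returns the first root of row z to the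
  multiset, which is the factor 1 - L of \<open>lowered\<close>. The disjunct
  \<open>l \<le> down_row k lam z\<close> replaces the descent when z is the bottom row.\<close>

lemma alternating_wKat:
  assumes "lam \<in> bounded_partitions_len k l" "z \<le> l"
    and "\<And>i. 1 \<le> i \<Longrightarrow> i < z \<Longrightarrow> lam (Suc i) < lam i"
    and "z = 0 \<or> lam (Suc z) < lam z \<or> l \<le> down_row k lam z"
  shows "alternating k (part_size lam) (wKat k l (Suc z) lam lam)"
  using assms
proof (induction z arbitrary: lam)
  case 0
  \<comment> \<open>Dropping the first root of every row amounts to increasing k by one.\<close>
  then have "lowering_roots k l (Suc 0) lam = Delta (k + 1) l lam"
    by (auto simp: lowering_roots_def Delta_def pos_roots_def)
  then have "wKat k l (Suc 0) lam lam = KkSchur k lam"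
    using Katalan_Delta_eq_KkSchur[OF 0(1)] by (simp add: wKat_def)
  moreover have "lam \<in> bounded_partitions k" using 0 by (auto simp: bounded_partitions_def)
  ultimately show ?case using alternating.KkSchur by metis
next
  case (Suc z)
  note lam = Suc.prems(1)
  let ?z = "Suc z"
  let ?d = "down_row k lam ?z"
  have "alternating k (part_size lam) (lowered k l ?z lam ?z)"
  proof (rule alternating_lowered[where \<nu> = lam])
    fix \<mu> assume \<mu>: "\<mu> \<in> bounded_partitions_len k l" "\<And>i. i \<le> ?z \<Longrightarrow> \<mu> i = lam i"
    show "alternating k (part_size \<mu>) (wKat k l ?z \<mu> \<mu>)"
      by (rule Suc.IH) (use \<mu> Suc.prems in auto)
  next
    show "anchored k ?z lam ?z \<or> l \<le> ?d"
      using Suc.prems(4) anchored.descent[of ?z ?z lam k] by auto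
  qed (use lam in auto)
  moreover have "lowered k l ?z lam ?z = wKat k l (Suc ?z) lam lam"
  proof (cases "?d \<le> l")
    case True
    then have "lowering_roots k l (Suc ?z) lam = insert (?z, ?d) (lowering_roots k l ?z lam)"
      by (auto simp: mem_lowering_roots_iff[OF lam] less_Suc_eq split: if_splits)
    moreover have "(?z, ?d) \<notin> lowering_roots k l ?z lam"
      by (simp add: mem_lowering_roots_iff[OF lam])
    ultimately have "Lmset (lowering_roots k l (Suc ?z) lam) =
        add_mset ?d (Lmset (lowering_roots k l ?z lam))"
      using Lmset_insert[OF finite_root_set[OF lowering_roots_subset]] by metis
    then show ?thesis using True by (simp add: lowered_def wKat_def Katalan_add_mset)
  next
    case False
    then have "lowering_roots k l (Suc ?z) lam = lowering_roots k l ?z lam"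
      by (auto simp: mem_lowering_roots_iff[OF lam] less_Suc_eq split: if_splits)
    then show ?thesis using False by (simp add: lowered_def wKat_def)
  qed
  ultimately show ?case by simp
qed

lemma alternating_expansion:
  assumes "alternating k n f"
  shows "\<exists>b :: vec_index \<Rightarrow> int. finite {\<mu>. b \<mu> \<noteq> 0} \<and> {\<mu>. b \<mu> \<noteq> 0} \<subseteq> bounded_partitions k \<and>
    f = (\<Sum>\<mu> | b \<mu> \<noteq> 0. of_int (b \<mu>) * KkSchur k \<mu>) \<and>
    (\<forall>\<mu>. (-1) ^ nat \<bar>n - part_size \<mu>\<bar> * b \<mu> \<ge> 0)"
  using assms
proof induction
  case (KkSchur \<mu>)
  then show ?case
    by (intro exI[of _ "\<lambda>\<nu>. if \<nu> = \<mu> then 1 else 0"]) auto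
next
  case (diff n f g)
  from diff.IH obtain a b :: "vec_index \<Rightarrow> int" where
    a: "finite {\<mu>. a \<mu> \<noteq> 0}" "{\<mu>. a \<mu> \<noteq> 0} \<subseteq> bounded_partitions k"
      "f = (\<Sum>\<mu> | a \<mu> \<noteq> 0. of_int (a \<mu>) * KkSchur k \<mu>)"
      "\<And>\<mu>. (-1) ^ nat \<bar>n - part_size \<mu>\<bar> * a \<mu> \<ge> 0" and
    b: "finite {\<mu>. b \<mu> \<noteq> 0}" "{\<mu>. b \<mu> \<noteq> 0} \<subseteq> bounded_partitions k"
      "g = (\<Sum>\<mu> | b \<mu> \<noteq> 0. of_int (b \<mu>) * KkSchur k \<mu>)"
      "\<And>\<mu>. (-1) ^ nat \<bar>n - 1 - part_size \<mu>\<bar> * b \<mu> \<ge> 0"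
    by blast
  let ?S = "{\<mu>. a \<mu> \<noteq> 0} \<union> {\<mu>. b \<mu> \<noteq> 0}"
  have sum: "(\<Sum>\<mu> | c \<mu> \<noteq> 0. of_int (c \<mu>) * KkSchur k \<mu>) = (\<Sum>\<mu>\<in>?S. of_int (c \<mu>) * KkSchur k \<mu>)"
    if "{\<mu>. c \<mu> \<noteq> 0} \<subseteq> ?S" for c
    by (rule sum.mono_neutral_left) (use that a b in auto)
  have sub: "{\<mu>. a \<mu> - b \<mu> \<noteq> 0} \<subseteq> ?S" by auto
  have "f - g = (\<Sum>\<mu> | a \<mu> - b \<mu> \<noteq> 0. of_int (a \<mu> - b \<mu>) * KkSchur k \<mu>)"
    unfolding a(3) b(3) sum[OF sub] by (subst (1 2) sum) (auto simp: sum_subtractf algebra_simps)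
  moreover have "(-1) ^ nat \<bar>n - part_size \<mu>\<bar> * (a \<mu> - b \<mu>) \<ge> 0" for \<mu>
  proof -
    \<comment> \<open>Passing from n to n - 1 flips the parity, so subtracting \<open>b\<close>
      combines coefficients of equal sign.\<close>
    have "even (nat \<bar>n - 1 - part_size \<mu>\<bar>) \<longleftrightarrow> odd (nat \<bar>n - part_size \<mu>\<bar>)"
      by (simp add: even_nat_iff) blast
    then have "(-1) ^ nat \<bar>n - 1 - part_size \<mu>\<bar> = - ((-1) ^ nat \<bar>n - part_size \<mu>\<bar> :: int)"
      by (cases "even (nat \<bar>n - part_size \<mu>\<bar>)") auto
    then show ?thesis using a(4)[of \<mu>] b(4)[of \<mu>] by (simp add: algebra_simps)
  qed
  moreover have "finite {\<mu>. a \<mu> - b \<mu> \<noteq> 0}" using a(1) b(1) by (intro finite_subset[OF sub]) simp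
  ultimately show ?case
    using a(2) b(2) sub by (intro exI[of _ "\<lambda>\<mu>. a \<mu> - b \<mu>"]) auto
qed

section \<open>The weighted function in terms of first roots of rows\<close>

lemma le_root_bottom:
  assumes "(x, j) \<in> Delta k l lam"
  shows "x \<le> root_bottom (Delta k l lam)"
  unfolding root_bottom_def
  using assms finite_root_set[OF Delta_subset_pos_roots] by (intro Max_ge) force+

lemma root_bottom_in:
  "root_bottom (Delta k l lam) \<in> insert 0 (fst ` Delta k l lam)"
  unfolding root_bottom_def
  by (rule Max_in) (use finite_root_set[OF Delta_subset_pos_roots] in auto)

text \<open>The removed values are second coordinates of the first roots of the rows from z to the
  bottom, so removing values amounts to removing these roots.\<close>

lemma weighted_KkSchur_eq_wKat:
  assumes lam: "lam \<in> bounded_partitions_len k l" and z: "1 \<le> z"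
  shows "weighted_KkSchur k l lam z = wKat k l z lam lam"
proof -
  let ?P = "Delta k l lam"
  let ?b = "root_bottom ?P" and ?f = "\<lambda>x. (x, down l ?P x)"
  let ?B = "?f ` {z..root_bottom ?P}"
  have fin: "finite ?P" by (rule finite_root_set[OF Delta_subset_pos_roots])
  have down: "down l ?P x = down_row k lam x" if "x \<in> {z..?b}" for x
    using down_Delta[OF lam, of x] int_down_row[OF lam, of x] that z by simp
  have B: "?B \<subseteq> ?P"
  proof
    fix \<alpha> assume "\<alpha> \<in> ?B"
    then obtain x where x: "x \<in> {z..?b}" "\<alpha> = (x, down_row k lam x)" using down by auto
    obtain p where "(?b, p) \<in> ?P" using root_bottom_in[of k l lam] x z by auto
    then have "down_row k lam ?b \<le> l" by (auto simp: mem_Delta_iff[OF lam])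
    moreover have "1 \<le> x" "x \<le> ?b" using x z by auto
    ultimately have "down_row k lam x \<le> l" using down_row_diff[OF lam, of x ?b] by linarith
    then show "\<alpha> \<in> ?P" using x z by (auto simp: mem_Delta_iff[OF lam])
  qed
  have "lowering_roots k l z lam = ?P - ?B"
  proof (rule Set.set_eqI)
    fix \<alpha> :: "nat \<times> nat"
    obtain i j where \<alpha>: "\<alpha> = (i, j)" by (cases \<alpha>)
    have "(i, j) \<in> ?B \<longleftrightarrow> z \<le> i \<and> i \<le> ?b \<and> j = down_row k lam i" using down by force
    then show "\<alpha> \<in> lowering_roots k l z lam \<longleftrightarrow> \<alpha> \<in> ?P - ?B"
      unfolding \<alpha> using le_root_bottom[of i j k l lam]
      by (auto simp: mem_lowering_roots_iff[OF lam] mem_Delta_iff[OF lam])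
  qed
  moreover have "mset_set ?P = mset_set (?P - ?B) + mset_set ?B"
    using mset_set_Union[of ?B "?P - ?B"] fin Diff_partition[OF B]
    by (simp add: Diff_disjoint add.commute)
  \<comment> \<open>Distinct rows have distinct first columns, so passing to the set of values loses
    no multiplicity.\<close>
  moreover have "inj_on (down l ?P) {z..?b}"
  proof (rule linorder_inj_onI)
    fix x y assume "x < y" "x \<in> {z..?b}" "y \<in> {z..?b}"
    then show "down l ?P x \<noteq> down l ?P y" using down_row_diff[OF lam, of x y] down z by simp
  qed auto
  then have "inj_on snd ?B" by (auto simp: inj_on_def)
  then have "Lmset ?B = mset_set (down l ?P ` {z..?b})"
    by (simp add: Lmset_def image_mset_mset_set image_image)
  ultimately have "Lmset ?P - mset_set (down l ?P ` {z..?b}) = Lmset (lowering_roots k l z lam)"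
    by (simp add: Lmset_def)
  then show ?thesis by (simp add: weighted_KkSchur_def wKat_def Let_def)
qed

theorem theorem1p2:
  fixes k l z :: nat and lam :: vec_index
  assumes "k \<ge> 1" and "l \<ge> 1"
    and "lam \<in> bounded_partitions_len k l"
    and "z \<le> root_bottom (Delta k l lam)"
    and "\<forall>i. 1 \<le> i \<and> i < z \<longrightarrow> lam i > lam (i + 1)"
    and "z \<noteq> 0 \<and> z \<noteq> root_bottom (Delta k l lam) \<longrightarrow> lam z > lam (z + 1)"
  shows "\<exists>b :: vec_index \<Rightarrow> int.
           finite {\<mu> \<in> bounded_partitions k. b \<mu> \<noteq> 0} \<and>
           weighted_KkSchur k l lam (z + 1) =
             (\<Sum>\<mu> | \<mu> \<in> bounded_partitions k \<and> b \<mu> \<noteq> 0. of_int (b \<mu>) * KkSchur k \<mu>) \<and>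
           (\<forall>\<mu> \<in> bounded_partitions k.
              (-1) ^ nat \<bar>part_size lam - part_size \<mu>\<bar> * b \<mu> \<ge> 0)"
proof -
  note lam = assms(3)
  let ?P = "Delta k l lam"
  have zl: "z \<le> l"
    using root_bottom_in[of k l lam] assms(4) by (auto simp: Delta_def pos_roots_def)
  have "lam (Suc z) < lam z \<or> l \<le> down_row k lam z" if "z \<noteq> 0"
  proof (cases "z = root_bottom ?P")
    case True
    \<comment> \<open>Row z + 1 has no root. If \<open>lam (Suc z) = lam z\<close>, the first column
      of row z is one to the left of that of row z + 1, hence at least l.\<close>
    then have "(Suc z, l) \<notin> ?P" using le_root_bottom[of "Suc z" l k l lam] by auto
    then have "l < down_row k lam (Suc z)" by (simp add: mem_Delta_iff[OF lam])
    moreover have "lam (Suc z) \<le> lam z"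
      using bounded_partitions_len_mono[OF lam, of z "Suc z"] that by simp
    ultimately show ?thesis using down_row_Suc[OF lam, of z] by linarith
  next
    case False
    then show ?thesis using assms(6) that by simp
  qed
  then have "alternating k (part_size lam) (wKat k l (Suc z) lam lam)"
    using assms(5) by (intro alternating_wKat[OF lam zl]) auto
  then obtain b :: "vec_index \<Rightarrow> int" where
    b: "finite {\<mu>. b \<mu> \<noteq> 0}" "{\<mu>. b \<mu> \<noteq> 0} \<subseteq> bounded_partitions k"
      "wKat k l (Suc z) lam lam = (\<Sum>\<mu> | b \<mu> \<noteq> 0. of_int (b \<mu>) * KkSchur k \<mu>)"
      "\<forall>\<mu>. (-1) ^ nat \<bar>part_size lam - part_size \<mu>\<bar> * b \<mu> \<ge> 0"
    using alternating_expansion by blast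
  have "{\<mu>. \<mu> \<in> bounded_partitions k \<and> b \<mu> \<noteq> 0} = {\<mu>. b \<mu> \<noteq> 0}" using b(2) by blast
  then show ?thesis
    using b weighted_KkSchur_eq_wKat[OF lam, of "Suc z"] by (intro exI[of _ b]) simp
qed

end
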